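(* Let $n\ge1$, let $A_i,B_i\in B(H)$ ($1\le i\le n$) be arbitrary operators (not assumed commuting or normal), and let $T\in B(H)$. Put $\Delta(X)=\sum_{i=1}^nA_iXB_i$ and $\Delta^*(X)=\sum_{i=1}^nA_i^*XB_i^*$ for $X\in B(H)$, and let $$S=\Big(\sum_{i=1}^n(A_iTB_i)\Big)\cap\Big(\sum_{i=1}^n(A_iT)(B_i)\Big)\cap\Big(\sum_{i=1}^n(A_i)(TB_i)\Big).$$ If $\omega\notin\Sigma(S)$, then $\Delta^*(\Delta(T))\in\mathscr L_1$ implies that $\Delta(T)\in\mathscr L_2$ and $\|\Delta(T)\|_2^2=Tr\,\big(T^*\Delta^*(\Delta(T))\big)$. In particular, if $\Delta^*(\Delta(T))=0$ then $\Delta(T)=0$.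
   Context: $H$ is a complex separable infinite-dimensional Hilbert space. $(X)$ denotes the principal two-sided ideal of $B(H)$ generated by the operator $X$ (here possibly $\{0\}$ or all of $B(H)$); for two-sided ideals $M,N$, $MN$ denotes their product (the linear span of the products $XY$, $X\in M$, $Y\in N$), and $\sum$ of ideals denotes their sum. In particular $(A_iT)(B_i)$ is the product of the principal ideals generated by $A_iT$ and $B_i$, and $(A_iTB_i)$ is the principal ideal generated by $A_iTB_i$. $\omega=\langle1/n\rangle_{n\ge1}$, and $\omega\notin\Sigma(S)$ means that the diagonal operator $\mathrm{diag}\langle1,\frac12,\frac13,\dots\rangle$ (with respect to an orthonormal basis) does not belong to $S$. $\mathscr L_1$ is the trace class with standard trace $Tr$; $\mathscr L_2$ is the Hilbert-Schmidt class with norm $\|\cdot\|_2$. *)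

theory Defs
  imports "HOL-Analysis.Analysis"
begin

section \<open>Complex Hilbert spaces\<close>

text \<open>
  The inner product is linear in the first argument. Only the complex structure is new:
  the norm, the topology and the underlying real inner product are those of the library, and
  \<open>inner_eq_Re_cinner\<close> makes \<open>norm x = sqrt (Re (cinner x x))\<close>.
\<close>

class chilbert_space = real_inner + complete_space +
  fixes scaleC :: "complex \<Rightarrow> 'a \<Rightarrow> 'a"  (infixr "*\<^sub>C" 75)
    and cinner :: "'a \<Rightarrow> 'a \<Rightarrow> complex"
  assumes scaleC_add_right: "c *\<^sub>C (x + y) = c *\<^sub>C x + c *\<^sub>C y"
    and scaleC_add_left: "(c + d) *\<^sub>C x = c *\<^sub>C x + d *\<^sub>C x"
    and scaleC_scaleC: "c *\<^sub>C d *\<^sub>C x = (c * d) *\<^sub>C x"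
    and scaleC_of_real: "complex_of_real r *\<^sub>C x = r *\<^sub>R x"
    and cinner_commute: "cinner x y = cnj (cinner y x)"
    and cinner_add_left: "cinner (x + y) z = cinner x z + cinner y z"
    and cinner_scaleC_left: "cinner (c *\<^sub>C x) y = c * cinner x y"
    and inner_eq_Re_cinner: "inner x y = Re (cinner x y)"

class separable_infinite_dim_chilbert_space = chilbert_space +
  assumes separable: "\<exists>D. countable D \<and> (\<forall>x. \<forall>\<epsilon>>0. \<exists>d\<in>D. dist d x < \<epsilon>)"
    and infinite_dim: "finite F \<Longrightarrow> \<exists>x. \<forall>c. x \<noteq> (\<Sum>v\<in>F. c v *\<^sub>C v)"

lemma norm_scaleC: "norm (c *\<^sub>C x) = cmod c * norm (x :: 'h::chilbert_space)"
proof -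
  have "cinner (c *\<^sub>C x) (c *\<^sub>C x) = c * cnj (c * cinner x x)"
    by (metis cinner_commute cinner_scaleC_left)
  also have "\<dots> = c * cnj c * cinner x x"
    using cinner_commute[of x x] by simp
  also have "\<dots> = complex_of_real ((cmod c)\<^sup>2) * cinner x x"
    by (simp only: complex_norm_square)
  finally have "inner (c *\<^sub>C x) (c *\<^sub>C x) = (cmod c)\<^sup>2 * inner x x"
    by (simp add: inner_eq_Re_cinner)
  then show ?thesis
    by (simp add: norm_eq_sqrt_inner real_sqrt_mult)
qed

lemma bounded_linear_scaleC: "bounded_linear (\<lambda>x :: 'h::chilbert_space. c *\<^sub>C x)"
proof (rule bounded_linear_intro[where K = "cmod c"])
  show "c *\<^sub>C (r *\<^sub>R x) = r *\<^sub>R (c *\<^sub>C x)" for r and x :: 'h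
    by (simp add: scaleC_of_real[symmetric] scaleC_scaleC mult.commute)
qed (simp_all add: scaleC_add_right norm_scaleC mult.commute)

definition orthonormal_basis :: "(nat \<Rightarrow> 'h::chilbert_space) \<Rightarrow> bool" where
  "orthonormal_basis e \<longleftrightarrow>
     (\<forall>i j. cinner (e i) (e j) = (if i = j then 1 else 0)) \<and>
     (\<forall>x. (\<forall>i. cinner x (e i) = 0) \<longrightarrow> x = 0)"

section \<open>Bounded operators\<close>

text \<open>
  The library type \<open>'h \<Rightarrow>\<^sub>L 'h\<close> consists of the real-linear bounded maps; \<open>B(H)\<close> is the set
  of those that are complex-linear.
\<close>

definition BH :: "('h::chilbert_space \<Rightarrow>\<^sub>L 'h) set" where
  "BH = {X :: 'h \<Rightarrow>\<^sub>L 'h. \<forall>c x. X (c *\<^sub>C x) = c *\<^sub>C X x}"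

lift_definition scale_op :: "complex \<Rightarrow> ('h::chilbert_space \<Rightarrow>\<^sub>L 'h) \<Rightarrow> ('h \<Rightarrow>\<^sub>L 'h)"
  is "\<lambda>c X x. c *\<^sub>C X x"
  by (rule bounded_linear_compose[OF bounded_linear_scaleC])

definition adj :: "('h::chilbert_space \<Rightarrow>\<^sub>L 'h) \<Rightarrow> ('h \<Rightarrow>\<^sub>L 'h)" where
  "adj X = (THE Y. Y \<in> BH \<and> (\<forall>x y. cinner (X x) y = cinner x (Y y)))"

definition positive_op :: "('h::chilbert_space \<Rightarrow>\<^sub>L 'h) \<Rightarrow> bool" where
  "positive_op P \<longleftrightarrow> P \<in> BH \<and> (\<forall>x. Im (cinner (P x) x) = 0 \<and> 0 \<le> Re (cinner (P x) x))"

definition abs_op :: "('h::chilbert_space \<Rightarrow>\<^sub>L 'h) \<Rightarrow> ('h \<Rightarrow>\<^sub>L 'h)" where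
  "abs_op X = (THE P. positive_op P \<and> P o\<^sub>L P = adj X o\<^sub>L X)"

definition diag_op ::
  "(nat \<Rightarrow> 'h::chilbert_space) \<Rightarrow> (nat \<Rightarrow> complex) \<Rightarrow> ('h \<Rightarrow>\<^sub>L 'h)" where
  "diag_op e d = (THE D. D \<in> BH \<and> (\<forall>k. D (e k) = d k *\<^sub>C e k))"

text \<open>The sequence \<open>1, 1/2, 1/3, \<dots>\<close>, indexed from \<open>0\<close>.\<close>

definition omega :: "nat \<Rightarrow> complex" where
  "omega k = 1 / of_nat (k + 1)"

section \<open>Trace class and Hilbert-Schmidt operators\<close>

text \<open>
  None of the notions below depends on the choice of the orthonormal basis. The trace and the
  Hilbert-Schmidt norm are defined as the common value over all bases.
\<close>

definition trace_class :: "('h::chilbert_space \<Rightarrow>\<^sub>L 'h) \<Rightarrow> bool" where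
  "trace_class X \<longleftrightarrow> X \<in> BH \<and>
     (\<exists>e. orthonormal_basis e \<and> summable (\<lambda>k. cinner (abs_op X (e k)) (e k)))"

definition op_trace :: "('h::chilbert_space \<Rightarrow>\<^sub>L 'h) \<Rightarrow> complex" where
  "op_trace X = (THE t. \<forall>e. orthonormal_basis e \<longrightarrow> (\<lambda>k. cinner (X (e k)) (e k)) sums t)"

definition hilbert_schmidt :: "('h::chilbert_space \<Rightarrow>\<^sub>L 'h) \<Rightarrow> bool" where
  "hilbert_schmidt X \<longleftrightarrow> X \<in> BH \<and>
     (\<forall>e. orthonormal_basis e \<longrightarrow> summable (\<lambda>k. (norm (X (e k)))\<^sup>2))"

definition hs_norm :: "('h::chilbert_space \<Rightarrow>\<^sub>L 'h) \<Rightarrow> real" where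
  "hs_norm X =
     sqrt (THE s. \<forall>e. orthonormal_basis e \<longrightarrow> (\<lambda>k. (norm (X (e k)))\<^sup>2) sums s)"

section \<open>Two-sided ideals of \<open>B(H)\<close>\<close>

definition two_sided_ideal :: "('h::chilbert_space \<Rightarrow>\<^sub>L 'h) set \<Rightarrow> bool" where
  "two_sided_ideal I \<longleftrightarrow> I \<subseteq> BH \<and> 0 \<in> I \<and>
     (\<forall>X\<in>I. \<forall>Y\<in>I. X + Y \<in> I) \<and>
     (\<forall>c. \<forall>X\<in>I. scale_op c X \<in> I) \<and>
     (\<forall>X\<in>I. \<forall>Y\<in>BH. X o\<^sub>L Y \<in> I \<and> Y o\<^sub>L X \<in> I)"

definition principal_ideal :: "('h::chilbert_space \<Rightarrow>\<^sub>L 'h) \<Rightarrow> ('h \<Rightarrow>\<^sub>L 'h) set" where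
  "principal_ideal X = \<Inter>{I. two_sided_ideal I \<and> X \<in> I}"

definition ideal_prod ::
  "('h::chilbert_space \<Rightarrow>\<^sub>L 'h) set \<Rightarrow> ('h \<Rightarrow>\<^sub>L 'h) set \<Rightarrow> ('h \<Rightarrow>\<^sub>L 'h) set" where
  "ideal_prod M N =
     {(\<Sum>k<m. scale_op (c k) (X k o\<^sub>L Y k)) | (m::nat) c X Y. \<forall>k<m. X k \<in> M \<and> Y k \<in> N}"

definition ideal_sum ::
  "nat \<Rightarrow> (nat \<Rightarrow> ('h::chilbert_space \<Rightarrow>\<^sub>L 'h) set) \<Rightarrow> ('h \<Rightarrow>\<^sub>L 'h) set" where
  "ideal_sum n I = {(\<Sum>i=1..n. X i) | X. \<forall>i\<in>{1..n}. X i \<in> I i}"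

section \<open>Elementary operators\<close>

definition elem_op ::
  "nat \<Rightarrow> (nat \<Rightarrow> ('h::chilbert_space \<Rightarrow>\<^sub>L 'h)) \<Rightarrow> (nat \<Rightarrow> ('h \<Rightarrow>\<^sub>L 'h)) \<Rightarrow>
     ('h \<Rightarrow>\<^sub>L 'h) \<Rightarrow> ('h \<Rightarrow>\<^sub>L 'h)" where
  "elem_op n A B X = (\<Sum>i=1..n. A i o\<^sub>L X o\<^sub>L B i)"

definition elem_op_star ::
  "nat \<Rightarrow> (nat \<Rightarrow> ('h::chilbert_space \<Rightarrow>\<^sub>L 'h)) \<Rightarrow> (nat \<Rightarrow> ('h \<Rightarrow>\<^sub>L 'h)) \<Rightarrow>
     ('h \<Rightarrow>\<^sub>L 'h) \<Rightarrow> ('h \<Rightarrow>\<^sub>L 'h)" where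
  "elem_op_star n A B = elem_op n (\<lambda>i. adj (A i)) (\<lambda>i. adj (B i))"

definition S_ideal ::
  "nat \<Rightarrow> (nat \<Rightarrow> ('h::chilbert_space \<Rightarrow>\<^sub>L 'h)) \<Rightarrow> (nat \<Rightarrow> ('h \<Rightarrow>\<^sub>L 'h)) \<Rightarrow>
     ('h \<Rightarrow>\<^sub>L 'h) \<Rightarrow> ('h \<Rightarrow>\<^sub>L 'h) set" where
  "S_ideal n A B T =
     ideal_sum n (\<lambda>i. principal_ideal (A i o\<^sub>L T o\<^sub>L B i)) \<inter>
     ideal_sum n (\<lambda>i. ideal_prod (principal_ideal (A i o\<^sub>L T)) (principal_ideal (B i))) \<inter>
     ideal_sum n (\<lambda>i. ideal_prod (principal_ideal (A i)) (principal_ideal (T o\<^sub>L B i)))"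

end

theory Submission
  imports Defs
begin

text \<open>
  Write \<open>D = \<Delta>(T)\<close>, \<open>L = \<Delta>\<^sup>*(D)\<close> and \<open>Z\<^sub>i = T\<^sup>* A\<^sub>i\<^sup>* D\<close>. The operator \<open>D\<close> lies in the ideal
  \<open>S\<close>, hence so do \<open>L\<close> and all \<open>Z\<^sub>i\<close>, and
  \<open>D\<^sup>* D - T\<^sup>* L = \<Sum>\<^sub>i (B\<^sub>i\<^sup>* Z\<^sub>i - Z\<^sub>i B\<^sub>i\<^sup>*)\<close>.
  So the claim is that this sum of commutators has trace zero although neither summand of a
  commutator need be of trace class.

  Compress to a subspace of dimension \<open>m\<close>. In the trace of a compressed commutator
  everything cancels that stays inside the subspace, and what is left is at most
  \<open>2 m \<eta> \<parallel>B\<parallel>\<close> if \<open>Z\<close> and \<open>Z\<^sup>*\<close> are bounded by \<open>\<eta>\<close> on the orthogonal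
  complement (\<open>compressed_trace_commutator\<close>). For every \<open>n\<close> there is a subspace of dimension
  \<open>O(n)\<close> for which \<open>\<eta>\<close> can be taken to be \<open>2 d n\<close>, where the diagonal operator of \<open>d\<close>
  belongs to \<open>S\<close>: a greedy choice of unit vectors on which \<open>Z\<close> is nearly as large as possible
  exhibits such a diagonal as a product \<open>W Z U\<close> (\<open>diagonal_compression\<close>,
  \<open>ideal_common_diagonal\<close>). Enlarge the subspace by the first \<open>n\<close> vectors of the basis.
  Then the compressed traces of \<open>T\<^sup>* L\<close> converge to its trace and those of \<open>D\<^sup>* D\<close> to
  \<open>\<parallel>D\<parallel>\<^sub>2\<^sup>2\<close>, possibly infinite. If the two limits differ, then the compressed traces of the
  sum of commutators stay away from 0 (\<open>compressed_trace_gap\<close>), so \<open>n * d n\<close> is bounded below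
  by a positive constant for large \<open>n\<close>, and the harmonic diagonal operator is a bounded multiple of the diagonal
  of \<open>d\<close>; thus it lies in \<open>S\<close> (\<open>omega_in_ideal\<close>).

  It remains to make sense of the trace of \<open>T\<^sup>* L\<close>. Since the harmonic diagonal is not in \<open>S\<close>, the
  same extraction of diagonals shows that the operators in \<open>S\<close> are compact
  (\<open>compact_if_omega_notin\<close>). The spectral theorem for \<open>L\<^sup>* L\<close> then identifies \<open>\<bar>L\<bar>\<close> and turns
  the trace class condition into an expansion \<open>L x = \<Sum>\<^sub>k \<langle>x, f\<^sub>k\<rangle> L f\<^sub>k\<close> with
  orthonormal \<open>f\<^sub>k\<close> and \<open>\<Sum>\<^sub>k \<parallel>L f\<^sub>k\<parallel> < \<infinity>\<close> (\<open>trace_class_expansion\<close>).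
\<close>

section \<open>The complex inner product\<close>

lemma cinner_add_right: "cinner x (y + z) = cinner x y + cinner x (z::'h::chilbert_space)"
  by (metis cinner_commute cinner_add_left complex_cnj_add)

lemma cinner_scaleC_right: "cinner x (c *\<^sub>C y) = cnj c * cinner x (y::'h::chilbert_space)"
  by (metis cinner_commute cinner_scaleC_left complex_cnj_mult)

lemma cinner_zero_left [simp]: "cinner 0 (y::'h::chilbert_space) = 0"
  using cinner_add_left[of 0 0 y] by simp

lemma cinner_zero_right [simp]: "cinner (y::'h::chilbert_space) 0 = 0"
  using cinner_add_right[of y 0 0] by simp

lemma cinner_minus_left: "cinner (- x) (y::'h::chilbert_space) = - cinner x y"
  using cinner_add_left[of x "- x" y] by (simp add: add_eq_0_iff)

lemma cinner_minus_right: "cinner x (- y::'h::chilbert_space) = - cinner x y"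
  using cinner_add_right[of x y "- y"] by (simp add: add_eq_0_iff)

lemma cinner_diff_left: "cinner (x - y) (z::'h::chilbert_space) = cinner x z - cinner y z"
  using cinner_add_left[of x "- y" z] by (simp add: cinner_minus_left)

lemma cinner_diff_right: "cinner z (x - y::'h::chilbert_space) = cinner z x - cinner z y"
  using cinner_add_right[of z x "- y"] by (simp add: cinner_minus_right)

lemma cinner_sum_left: "cinner (\<Sum>i\<in>I. f i) (y::'h::chilbert_space) = (\<Sum>i\<in>I. cinner (f i) y)"
  by (induction I rule: infinite_finite_induct) (auto simp: cinner_add_left)

lemma cinner_sum_right: "cinner (y::'h::chilbert_space) (\<Sum>i\<in>I. f i) = (\<Sum>i\<in>I. cinner y (f i))"
  by (induction I rule: infinite_finite_induct) (auto simp: cinner_add_right)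

lemma cinner_scaleR_left: "cinner (r *\<^sub>R x) (y::'h::chilbert_space) = of_real r * cinner x y"
  by (metis cinner_scaleC_left scaleC_of_real)

lemma cinner_scaleR_right: "cinner x (r *\<^sub>R y::'h::chilbert_space) = of_real r * cinner x y"
  by (metis cinner_scaleC_right scaleC_of_real complex_cnj_complex_of_real)

lemmas cinner_simps = cinner_add_left cinner_add_right cinner_diff_left cinner_diff_right
  cinner_scaleC_left cinner_scaleC_right cinner_sum_left cinner_sum_right

lemma cinner_self: "cinner x x = complex_of_real ((norm (x::'h::chilbert_space))\<^sup>2)"
proof -
  have "Im (cinner x x) = 0"
    using arg_cong[OF cinner_commute[of x x], of Im] by simp
  then show ?thesis
    by (simp add: complex_eq_iff power2_norm_eq_inner inner_eq_Re_cinner)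
qed

lemma cinner_self_eq_0 [simp]: "cinner x x = 0 \<longleftrightarrow> x = (0::'h::chilbert_space)"
  by (simp add: cinner_self)

lemma scaleC_one [simp]: "1 *\<^sub>C (x::'h::chilbert_space) = x"
  using scaleC_of_real[of 1 x] by simp

lemma scaleC_zero_left [simp]: "0 *\<^sub>C (x::'h::chilbert_space) = 0"
  using scaleC_of_real[of 0 x] by simp

lemma scaleC_zero_right [simp]: "c *\<^sub>C (0::'h::chilbert_space) = 0"
  using norm_scaleC[of c "0::'h"] by simp

lemma scaleC_sum_right: "c *\<^sub>C (\<Sum>i\<in>I. f i) = (\<Sum>i\<in>I. c *\<^sub>C (f i :: 'h::chilbert_space))"
  by (rule linear_sum) (rule bounded_linear.linear[OF bounded_linear_scaleC])

lemma cinner_Cauchy_Schwarz: "cmod (cinner x y) \<le> norm x * norm (y::'h::chilbert_space)"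
proof -
  define c where "c = cinner x y"
  have "cmod c = Re (cnj (sgn c) * c)"
  proof (cases "c = 0")
    case False
    have "cnj (sgn c) * c = of_real (cmod c)"
    proof -
      have "c * cnj c = of_real (cmod c) * of_real (cmod c)"
        by (simp only: complex_norm_square[symmetric] power2_eq_square of_real_mult)
      then show ?thesis
        using False by (simp add: sgn_div_norm scaleR_conv_of_real field_simps)
    qed
    then show ?thesis by simp
  qed simp
  also have "\<dots> = inner (cnj (sgn c) *\<^sub>C x) y"
    by (simp add: inner_eq_Re_cinner cinner_scaleC_left c_def)
  also have "\<dots> \<le> norm (cnj (sgn c) *\<^sub>C x) * norm y"
    by (rule norm_cauchy_schwarz)
  also have "\<dots> \<le> norm x * norm y"
    by (intro mult_right_mono) (auto simp: norm_scaleC norm_sgn)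
  finally show ?thesis by (simp add: c_def)
qed

lemma bounded_linear_cinner_left: "bounded_linear (\<lambda>x::'h::chilbert_space. cinner x y)"
  by (rule bounded_linear_intro[where K = "norm y"])
    (auto simp: cinner_add_left cinner_scaleR_left scaleR_conv_of_real cinner_Cauchy_Schwarz)

lemma bounded_linear_cinner_right: "bounded_linear (\<lambda>y::'h::chilbert_space. cinner x y)"
  by (rule bounded_linear_intro[where K = "norm x"])
    (auto simp: cinner_add_right cinner_scaleR_right scaleR_conv_of_real
      cinner_Cauchy_Schwarz mult.commute[of _ "norm x"])

lemma cinner_ext: "(\<And>x. cinner x y = cinner x z) \<Longrightarrow> y = (z::'h::chilbert_space)"
  by (metis cinner_diff_right cinner_self_eq_0 right_minus_eq)

lemma norm_square_add_orthogonal: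
  "cinner x y = 0 \<Longrightarrow> (norm (x + y))\<^sup>2 = (norm x)\<^sup>2 + (norm (y::'h::chilbert_space))\<^sup>2"
  by (simp add: power2_norm_eq_inner inner_eq_Re_cinner cinner_add_left cinner_add_right
      cinner_commute[of y x])

section \<open>Finite orthonormal families\<close>

definition orthonormal_family :: "(nat \<Rightarrow> 'h::chilbert_space) \<Rightarrow> nat \<Rightarrow> bool" where
  "orthonormal_family g m \<longleftrightarrow> (\<forall>i<m. \<forall>j<m. cinner (g i) (g j) = (if i = j then 1 else 0))"

definition proj :: "(nat \<Rightarrow> 'h::chilbert_space) \<Rightarrow> nat \<Rightarrow> 'h \<Rightarrow> 'h" where
  "proj g m x = (\<Sum>j<m. cinner x (g j) *\<^sub>C g j)"

lemma orthonormal_family_norm: "orthonormal_family g m \<Longrightarrow> j < m \<Longrightarrow> norm (g j) = 1"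
  using inner_eq_Re_cinner[of "g j" "g j"] by (simp add: orthonormal_family_def norm_eq_sqrt_inner)

lemma cinner_proj_basis:
  assumes "orthonormal_family g m" "j < m"
  shows "cinner (proj g m x) (g j) = cinner x (g j)"
proof -
  have "cinner (proj g m x) (g j) = (\<Sum>i<m. cinner x (g i) * (if i = j then 1 else 0))"
    using assms by (auto simp: proj_def cinner_simps orthonormal_family_def intro!: sum.cong)
  also have "\<dots> = cinner x (g j)" using assms by (simp add: if_distrib cong: if_cong)
  finally show ?thesis .
qed

lemma cinner_diff_proj_basis:
  "orthonormal_family g m \<Longrightarrow> j < m \<Longrightarrow> cinner (x - proj g m x) (g j) = 0"
  by (simp add: cinner_diff_left cinner_proj_basis)

lemma cinner_diff_proj_proj:
  assumes "orthonormal_family g m"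
  shows "cinner (x - proj g m x) (proj g m y) = 0"
  using cinner_diff_proj_basis[OF assms]
  by (simp add: proj_def[of g m y] cinner_sum_right cinner_scaleC_right)

lemma cinner_proj: "cinner (proj g m x) y = (\<Sum>j<m. cinner x (g j) * cinner (g j) y)"
  by (simp add: proj_def cinner_simps)

lemma cinner_proj_right: "cinner y (proj g m x) = (\<Sum>j<m. cinner y (g j) * cinner (g j) x)"
proof -
  have "cnj (cinner x (g j)) = cinner (g j) x" for j by (metis cinner_commute)
  then show ?thesis by (simp add: proj_def cinner_simps mult.commute)
qed

lemma norm_square_proj_split:
  assumes "orthonormal_family g m"
  shows "(norm x)\<^sup>2 = (norm (proj g m x))\<^sup>2 + (norm (x - proj g m x))\<^sup>2"
proof -
  have "cinner (proj g m x) (x - proj g m x) = 0"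
    using cinner_diff_proj_proj[OF assms, of x x] by (metis cinner_commute complex_cnj_zero)
  from norm_square_add_orthogonal[OF this] show ?thesis by simp
qed

lemma norm_proj_square:
  assumes "orthonormal_family g m"
  shows "(norm (proj g m x))\<^sup>2 = (\<Sum>j<m. (cmod (cinner x (g j)))\<^sup>2)"
proof -
  have "complex_of_real ((norm (proj g m x))\<^sup>2) = cinner (proj g m x) (proj g m x)"
    by (simp add: cinner_self)
  also have "\<dots> = cinner x (proj g m x)"
    using cinner_diff_proj_proj[OF assms, of x x] by (simp add: cinner_diff_left)
  also have "\<dots> = complex_of_real (\<Sum>j<m. (cmod (cinner x (g j)))\<^sup>2)"
    unfolding cinner_proj_right of_real_sum
  proof (rule sum.cong)
    fix j show "cinner x (g j) * cinner (g j) x = complex_of_real ((cmod (cinner x (g j)))\<^sup>2)"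
      by (simp only: cinner_commute[of "g j" x] complex_norm_square)
  qed simp
  finally show ?thesis by (simp only: of_real_eq_iff)
qed

lemma norm_proj_le:
  assumes "orthonormal_family g m"
  shows "norm (proj g m x) \<le> norm x"
proof (rule power2_le_imp_le)
  show "(norm (proj g m x))\<^sup>2 \<le> (norm x)\<^sup>2"
    unfolding norm_square_proj_split[OF assms, of x] by simp
qed simp

lemma norm_diff_proj_le:
  assumes "orthonormal_family g m"
  shows "norm (x - proj g m x) \<le> norm x"
proof (rule power2_le_imp_le)
  show "(norm (x - proj g m x))\<^sup>2 \<le> (norm x)\<^sup>2"
    unfolding norm_square_proj_split[OF assms, of x] by simp
qed simp

lemma proj_add: "proj g m (x + y) = proj g m x + proj g m y"
  by (simp add: proj_def cinner_add_left scaleC_add_left sum.distrib)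

lemma proj_diff: "proj g m (x - y) = proj g m x - proj g m y"
  using proj_add[of g m "x - y" y] by simp

lemma proj_scaleC: "proj g m (c *\<^sub>C x) = c *\<^sub>C proj g m x"
  by (simp add: proj_def cinner_scaleC_left scaleC_scaleC scaleC_sum_right)

lemma proj_sum: "proj g m (\<Sum>i\<in>I. f i) = (\<Sum>i\<in>I. proj g m (f i))"
proof (induction I rule: infinite_finite_induct)
  case (insert i I) then show ?case by (simp add: proj_add)
qed (simp_all add: proj_def)

text \<open>
  That \<open>g\<close> spans a larger subspace than \<open>u\<close> is expressed by \<open>proj g m\<close> fixing the vectors of \<open>u\<close>.
  Arbitrary compressions are compared in this way with those to the first vectors of a basis.
\<close>

lemma norm_diff_proj_mono:
  assumes g: "orthonormal_family g m" and fixed: "\<And>k. k < n \<Longrightarrow> proj g m (u k) = u k"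
  shows "norm (x - proj g m x) \<le> norm (x - proj u n x)"
proof -
  have "proj g m (proj u n x) = proj u n x"
    by (simp add: proj_def[of u n x] proj_sum proj_scaleC fixed)
  then have "x - proj g m x = (x - proj u n x) - proj g m (x - proj u n x)"
    by (simp add: proj_diff)
  then show ?thesis using norm_diff_proj_le[OF g] by metis
qed

text \<open>
  That a vector lies in the span of an orthonormal family is expressed by the projection fixing it;
  the count \<open>m \<le> card V\<close> is what bounds the dimension of compressions later on.
\<close>

lemma Gram_Schmidt:
  assumes "finite V"
  obtains g m where "orthonormal_family g m" "m \<le> card V" "\<And>v. v \<in> V \<Longrightarrow> proj g m v = v"
proof -
  have "\<exists>g m. orthonormal_family g m \<and> m \<le> card V \<and> (\<forall>v\<in>V. proj g m v = v)"
    using assms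
  proof induction
    case empty
    have "orthonormal_family (\<lambda>_. 0) 0" by (simp add: orthonormal_family_def)
    then show ?case by auto
  next
    case (insert v V)
    then obtain g m where g: "orthonormal_family g m" "m \<le> card V" "\<And>u. u \<in> V \<Longrightarrow> proj g m u = u"
      by blast
    define w where "w = v - proj g m v"
    show ?case
    proof (cases "w = 0")
      case True
      then have "proj g m v = v" by (simp add: w_def)
      then show ?thesis using g insert by (intro exI[of _ g] exI[of _ m]) auto
    next
      case False
      define g' where "g' = g(m := inverse (norm w) *\<^sub>R w)"
      have orth: "cinner (g m') (g' m) = 0" "cinner (g' m) (g m') = 0" if "m' < m" for m'
      proof -
        show "cinner (g' m) (g m') = 0"
          using cinner_diff_proj_basis[OF g(1) that, of v]
          by (simp add: g'_def cinner_scaleR_left w_def)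
        then show "cinner (g m') (g' m) = 0" by (metis cinner_commute complex_cnj_zero)
      qed
      have unit: "cinner (g' m) (g' m) = 1"
        using False by (simp add: g'_def cinner_self)
      have g': "orthonormal_family g' (Suc m)"
        using g(1) orth unit unfolding orthonormal_family_def
        by (auto simp: less_Suc_eq g'_def)
      have eq: "proj g' (Suc m) x = proj g m x + cinner x (g' m) *\<^sub>C g' m" for x
        by (simp add: proj_def g'_def)
      have "proj g' (Suc m) u = u" if "u \<in> insert v V" for u
      proof (cases "u = v")
        case True
        have "cinner (proj g m v) w = 0"
          using cinner_diff_proj_proj[OF g(1), of v v] cinner_commute[of "proj g m v" w]
          by (simp add: w_def)
        then have "cinner v w = cinner w w"
          using cinner_add_left[of w "proj g m v" w] by (simp add: w_def)
        moreover have "inverse (complex_of_real (norm w)) *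
            (complex_of_real (norm w) * complex_of_real (norm w)) * inverse (complex_of_real (norm w)) = 1"
          using False by (simp add: field_simps)
        ultimately have "cinner v (g' m) *\<^sub>C g' m = w"
          using False by (simp add: g'_def cinner_scaleC_right cinner_self scaleC_of_real[symmetric]
              scaleC_scaleC power2_eq_square)
        then show ?thesis using True by (simp add: eq w_def)
      next
        case False
        then have "proj g m u = u" using that g(3) by simp
        moreover have "cinner (proj g m u) (g' m) = 0"
          using orth by (simp add: cinner_proj)
        ultimately show ?thesis by (simp add: eq)
      qed
      then show ?thesis using g' g(2) insert
        by (intro exI[of _ g'] exI[of _ "Suc m"]) auto
    qed
  qed
  then show ?thesis using that by blast
qed

lemma diff_proj_orthogonal:
  assumes "orthonormal_family g m" "proj g m v = v"
  shows "cinner (x - proj g m x) v = 0"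
  using cinner_diff_proj_proj[OF assms(1), of x v] assms(2) by simp

lemma ex_unit_vector_orthogonal:
  assumes "finite (V :: 'h::separable_infinite_dim_chilbert_space set)"
  obtains x where "norm x = 1" "\<And>v. v \<in> V \<Longrightarrow> cinner x v = 0"
proof -
  obtain g m where g: "orthonormal_family g m" "\<And>v. v \<in> V \<Longrightarrow> proj g m v = v"
    using Gram_Schmidt[OF assms] by metis
  obtain z where z: "\<And>c. z \<noteq> (\<Sum>v\<in>g ` {..<m}. c v *\<^sub>C v)"
    using infinite_dim[of "g ` {..<m}"] by auto
  have inj: "inj_on g {..<m}"
    using g(1) unfolding inj_on_def orthonormal_family_def by (metis lessThan_iff zero_neq_one)
  have "z \<noteq> proj g m z"
    using z[of "\<lambda>v. cinner z v"] by (simp add: proj_def sum.reindex[OF inj])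
  then have nz: "z - proj g m z \<noteq> 0" by simp
  show ?thesis
  proof (rule that[of "inverse (norm (z - proj g m z)) *\<^sub>R (z - proj g m z)"])
    show "norm (inverse (norm (z - proj g m z)) *\<^sub>R (z - proj g m z)) = 1" using nz by simp
  qed (use g in \<open>simp add: cinner_scaleR_left diff_proj_orthogonal\<close>)
qed

section \<open>Norm attainment and adjoints\<close>

text \<open>
  For a maximising sequence of unit vectors whose images converge, the midpoints are again nearly
  maximising, so their norms tend to 1; by the parallelogram law the sequence is Cauchy. Applied to
  functionals this gives the Riesz representation, and applied to compact operators the spectral
  theorem.
\<close>

lemma compact_maps_attain_norm:
  fixes L :: "'a::{real_inner,complete_space} \<Rightarrow> 'b::real_normed_vector"
  assumes L: "bounded_linear L" and M: "subspace M" "closed M"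
    and u: "u \<in> M" "u \<noteq> 0"
    and compact: "\<And>y. (\<And>k::nat. y k \<in> M \<and> norm (y k) = 1) \<Longrightarrow>
       \<exists>z r. strict_mono r \<and> (\<lambda>k. L (y (r k))) \<longlonglongrightarrow> z"
  obtains x where "x \<in> M" "norm x = 1" "\<And>y. y \<in> M \<Longrightarrow> norm (L y) \<le> norm (L x) * norm y"
proof -
  interpret L: bounded_linear L by (rule L)
  obtain K where K: "\<And>x. norm (L x) \<le> norm x * K" using L.bounded by blast
  define U where "U = {x \<in> M. norm x = 1}"
  define s where "s = (SUP x\<in>U. norm (L x))"
  have "inverse (norm u) *\<^sub>R u \<in> U"
    using u M(1) by (simp add: U_def subspace_mul)
  then have U: "U \<noteq> {}" by blast
  have bdd: "bdd_above ((\<lambda>x. norm (L x)) ` U)"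
  proof (rule bdd_aboveI2)
    fix x assume "x \<in> U"
    then show "norm (L x) \<le> K" using K[of x] by (simp add: U_def)
  qed
  have le: "norm (L y) \<le> s * norm y" if "y \<in> M" for y
  proof (cases "y = 0")
    case False
    have "inverse (norm y) *\<^sub>R y \<in> U"
      using that False M(1) by (simp add: U_def subspace_mul)
    then have "norm (L (inverse (norm y) *\<^sub>R y)) \<le> s"
      unfolding s_def by (rule cSUP_upper[OF _ bdd])
    then show ?thesis using False by (simp add: L.scaleR field_simps)
  qed (simp add: L.zero)
  have "\<exists>x\<in>U. s - 1 / real (Suc k) < norm (L x)" for k
    using less_cSUP_iff[OF U bdd, of "s - 1 / real (Suc k)"] by (simp add: s_def)
  then obtain y where y: "\<And>k. y k \<in> U" "\<And>k. s - 1 / real (Suc k) < norm (L (y k))"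
    by metis
  obtain z r where r: "strict_mono (r::nat\<Rightarrow>nat)" and z: "(\<lambda>k. L (y (r k))) \<longlonglongrightarrow> z"
    using compact[of y] y(1) by (auto simp: U_def)
  have "norm z = s"
  proof (rule LIMSEQ_unique[OF tendsto_norm[OF z]])
    have "(\<lambda>k. norm (L (y k))) \<longlonglongrightarrow> s"
    proof (rule tendsto_sandwich)
      show "\<forall>\<^sub>F k in sequentially. s - 1 / real (Suc k) \<le> norm (L (y k))"
        by (intro always_eventually allI less_imp_le y(2))
      show "\<forall>\<^sub>F k in sequentially. norm (L (y k)) \<le> s"
        using y(1) le by (force simp: U_def intro!: always_eventually)
      show "(\<lambda>k. s - 1 / real (Suc k)) \<longlonglongrightarrow> s"
        using tendsto_diff[OF tendsto_const LIMSEQ_inverse_real_of_nat, of s]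
        by (simp add: inverse_eq_divide)
    qed simp
    then show "(\<lambda>k. norm (L (y (r k)))) \<longlonglongrightarrow> s"
      using LIMSEQ_subseq_LIMSEQ[OF _ r] by (force simp: o_def)
  qed
  show ?thesis
  proof (cases "s = 0")
    case True
    from U obtain x where "x \<in> U" by blast
    then show ?thesis using True le by (intro that[of x]) (auto simp: U_def)
  next
    case False
    then have s: "s > 0" using \<open>norm z = s\<close> norm_ge_zero[of z] by linarith
    let ?y = "\<lambda>k. y (r k)"
    \<comment> \<open>If \<open>L ?y\<close> is close to \<open>z\<close> then so is \<open>L\<close> of the midpoint of two members; the midpoint
      therefore has norm close to 1, and the parallelogram law makes the members close.\<close>
    have close: "(norm (?y k - ?y l))\<^sup>2 \<le> 8 * \<epsilon> / s"
      if "norm (L (?y k) - z) < \<epsilon>" "norm (L (?y l) - z) < \<epsilon>" for k l \<epsilon>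
    proof -
      have "2 * s = norm (z + z)"
        using \<open>norm z = s\<close> by (simp flip: scaleR_2)
      also have "z + z = L (?y k + ?y l) - ((L (?y k) - z) + (L (?y l) - z))"
        by (simp add: L.add)
      also have "norm \<dots> \<le> norm (L (?y k + ?y l)) + (norm (L (?y k) - z) + norm (L (?y l) - z))"
        by (intro norm_triangle_le_diff order_refl add_left_mono norm_triangle_ineq)
      also have "norm (L (?y k + ?y l)) \<le> s * norm (?y k + ?y l)"
        using y(1) M(1) by (intro le) (auto simp: U_def subspace_add)
      finally have "2 * s - 2 * \<epsilon> \<le> s * norm (?y k + ?y l)" using that by linarith
      then have "2 - 2 * \<epsilon> / s \<le> norm (?y k + ?y l)" using s by (simp add: field_simps)
      moreover have nn: "norm (?y k + ?y l) \<le> 2"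
        using norm_triangle_ineq[of "?y k" "?y l"] y(1) by (simp add: U_def)
      ultimately have "(2 - norm (?y k + ?y l)) * (2 + norm (?y k + ?y l)) \<le> (2 * \<epsilon> / s) * 4"
        using that s norm_ge_zero[of "L (?y k) - z"] by (intro mult_mono) (auto intro!: divide_nonneg_pos)
      moreover have "(norm (?y k - ?y l))\<^sup>2 + (norm (?y k + ?y l))\<^sup>2 = 4"
      proof -
        have "inner (?y k) (?y k) = 1" "inner (?y l) (?y l) = 1"
          using y(1) by (simp_all add: U_def norm_eq_sqrt_inner)
        then show ?thesis
          by (simp add: power2_norm_eq_inner inner_add inner_diff inner_commute)
      qed
      ultimately show ?thesis by (simp add: algebra_simps power2_eq_square)
    qed
    have "Cauchy ?y"
    proof (rule metric_CauchyI)
      fix \<epsilon> :: real assume \<epsilon>: "\<epsilon> > 0"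
      define \<delta> where "\<delta> = \<epsilon>\<^sup>2 * s / 16"
      have \<delta>: "\<delta> > 0" using \<epsilon> s by (simp add: \<delta>_def)
      obtain N where N: "\<And>k. k \<ge> N \<Longrightarrow> norm (L (?y k) - z) < \<delta>"
        using z \<delta> unfolding LIMSEQ_iff by blast
      have "dist (?y k) (?y l) < \<epsilon>" if "k \<ge> N" "l \<ge> N" for k l
      proof -
        have "(norm (?y k - ?y l))\<^sup>2 \<le> \<epsilon>\<^sup>2 / 2"
          using close[OF N[OF that(1)] N[OF that(2)]] s by (simp add: \<delta>_def)
        also have "\<dots> < \<epsilon>\<^sup>2" using \<epsilon> by simp
        finally show ?thesis using \<epsilon> by (simp add: dist_norm power2_less_imp_less)
      qed
      then show "\<exists>N. \<forall>m\<ge>N. \<forall>n\<ge>N. dist (?y m) (?y n) < \<epsilon>" by blast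
    qed
    then obtain x where x: "?y \<longlonglongrightarrow> x" using Cauchy_convergent convergent_def by blast
    have "x \<in> M" using closed_sequentially[OF M(2) _ x] y(1) by (auto simp: U_def)
    moreover have "norm x = 1"
      using LIMSEQ_unique[OF tendsto_norm[OF x]] y(1) by (simp add: U_def)
    moreover have "L x = z" using LIMSEQ_unique[OF L.tendsto[OF x] z] .
    ultimately show ?thesis using le \<open>norm z = s\<close> by (intro that[of x]) auto
  qed
qed

lemma norm_attaining_first_order:
  fixes L :: "'a::real_inner \<Rightarrow> 'b::real_inner"
  assumes L: "bounded_linear L" and M: "subspace M" "x \<in> M" "w \<in> M" and x: "norm x = 1"
    and le: "\<And>y. y \<in> M \<Longrightarrow> norm (L y) \<le> norm (L x) * norm y"
  shows "inner (L x) (L w) = (norm (L x))\<^sup>2 * inner x w"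
proof -
  interpret L: bounded_linear L by (rule L)
  define s where "s = (norm (L x))\<^sup>2"
  define a where "a = s * inner x w - inner (L x) (L w)"
  define b where "b = s * inner w w - inner (L w) (L w)"
  have xx: "inner x x = 1" using x by (simp add: norm_eq_sqrt_inner)
  have s: "inner (L x) (L x) = s" by (simp add: s_def power2_norm_eq_inner)
  \<comment> \<open>The quadratic polynomial \<open>s\<parallel>x + tw\<parallel>\<^sup>2 - \<parallel>L(x + tw)\<parallel>\<^sup>2\<close> is nonnegative and vanishes at \<open>t = 0\<close>.\<close>
  have pos: "0 \<le> 2 * t * a + t\<^sup>2 * b" for t
  proof -
    have "norm (L (x + t *\<^sub>R w)) \<le> norm (L x) * norm (x + t *\<^sub>R w)"
      using M by (intro le) (simp add: subspace_add subspace_mul)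
    then have "(norm (L (x + t *\<^sub>R w)))\<^sup>2 \<le> s * (norm (x + t *\<^sub>R w))\<^sup>2"
      unfolding s_def by (metis norm_ge_zero power_mono power_mult_distrib)
    then have "inner (L (x + t *\<^sub>R w)) (L (x + t *\<^sub>R w)) \<le> s * inner (x + t *\<^sub>R w) (x + t *\<^sub>R w)"
      by (simp only: power2_norm_eq_inner)
    then show ?thesis
      by (simp add: L.add L.scaleR inner_add xx s a_def b_def inner_commute
          algebra_simps power2_eq_square)
  qed
  have "a = 0"
  proof (rule ccontr)
    assume "a \<noteq> 0"
    define q where "q = \<bar>b\<bar> + 1"
    define t where "t = - a / q"
    have q: "q > 0" by (simp add: q_def)
    have "2 * t * a + t\<^sup>2 * b \<le> 2 * t * a + t\<^sup>2 * q"
      by (intro add_left_mono mult_left_mono) (auto simp: q_def)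
    also have "\<dots> = - (a\<^sup>2 / q)"
      using q by (simp add: t_def field_simps power2_eq_square)
    also have "\<dots> < 0" using \<open>a \<noteq> 0\<close> q by simp
    finally show False using pos[of t] by simp
  qed
  then show ?thesis by (simp add: a_def s_def)
qed

text \<open>
  At a unit vector where \<open>f\<close> attains its norm, the first-order condition says that \<open>f\<close> is a
  multiple of the inner product with that vector.
\<close>

lemma Riesz_representation:
  fixes f :: "'a::{real_inner,complete_space} \<Rightarrow> real"
  assumes f: "bounded_linear f"
  obtains z where "\<And>x. f x = inner x z"
proof (cases "\<forall>x. f x = 0")
  case True then show ?thesis using that[of 0] by simp
next
  case False
  interpret f: bounded_linear f by (rule f)
  obtain u where u: "f u \<noteq> 0" using False by blast
  then have "u \<noteq> 0" using f.zero by auto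
  obtain K where K: "\<And>x. norm (f x) \<le> norm x * K" using f.bounded by blast
  have "\<exists>z r. strict_mono r \<and> (\<lambda>k. f (y (r k))) \<longlonglongrightarrow> z"
    if y: "\<And>k::nat. y k \<in> UNIV \<and> norm (y k) = 1" for y
  proof -
    have "f (y k) \<in> {-K..K}" for k using K[of "y k"] y[of k] by auto
    then have "\<exists>l\<in>{-K..K}. \<exists>r. strict_mono r \<and> ((\<lambda>k. f (y k)) \<circ> r) \<longlonglongrightarrow> l"
      using compact_imp_seq_compact[OF compact_Icc, of "-K" K] unfolding seq_compact_def
      by (elim allE[of _ "\<lambda>k. f (y k)"]) simp
    then show ?thesis by (auto simp: o_def)
  qed
  from compact_maps_attain_norm[OF f subspace_UNIV closed_UNIV UNIV_I \<open>u \<noteq> 0\<close> this]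
  obtain x where x: "norm x = 1" "\<And>y. norm (f y) \<le> norm (f x) * norm y" by (metis UNIV_I)
  have "f x \<noteq> 0" using x(2)[of u] u by auto
  moreover have "f x * f w = (f x)\<^sup>2 * inner x w" for w
    using norm_attaining_first_order[OF f subspace_UNIV, of x w] x by simp
  ultimately have "f w = f x * inner x w" for w
    unfolding power2_eq_square mult.assoc by (metis mult_left_cancel)
  then have "f w = inner w (f x *\<^sub>R x)" for w by (metis inner_commute inner_scaleR_right)
  then show ?thesis by (rule that)
qed

lemma BH_scaleC: "X \<in> BH \<Longrightarrow> X (c *\<^sub>C x) = c *\<^sub>C X x"
  by (simp add: BH_def)

text \<open>
  The Riesz representation only provides an adjoint for the real inner product. Comparing real
  parts at \<open>x\<close> and at \<open>\<i> x\<close> turns it into one for the complex inner product.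
\<close>

lemma ex_adjoint:
  fixes X :: "'h::chilbert_space \<Rightarrow>\<^sub>L 'h"
  assumes X: "X \<in> BH"
  obtains Y where "Y \<in> BH" "\<And>x y. cinner (X x) y = cinner x (Y y)"
proof -
  have "\<exists>z. \<forall>x. inner (X x) y = inner x z" for y
  proof -
    have "bounded_linear (\<lambda>x. inner (X x) y)"
      by (intro bounded_linear_compose[OF bounded_linear_inner_left blinfun.bounded_linear_right])
    from Riesz_representation[OF this] show ?thesis by metis
  qed
  then obtain Y where Y: "\<And>x y. inner (X x) y = inner x (Y y)" by metis
  have c: "cinner (X x) y = cinner x (Y y)" for x y
  proof (rule complex_eqI)
    show "Re (cinner (X x) y) = Re (cinner x (Y y))" using Y by (simp add: inner_eq_Re_cinner)
    have "Re (\<i> * cinner (X x) y) = Re (\<i> * cinner x (Y y))"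
      using Y[of "\<i> *\<^sub>C x" y] X by (simp only: inner_eq_Re_cinner BH_scaleC cinner_scaleC_left)
    then show "Im (cinner (X x) y) = Im (cinner x (Y y))" by simp
  qed
  have lin: "bounded_linear Y"
  proof (rule bounded_linear_intro[where K = "norm X"])
    show "Y (x + y) = Y x + Y y" for x y by (rule cinner_ext) (simp add: cinner_add_right c[symmetric])
    show "Y (r *\<^sub>R x) = r *\<^sub>R Y x" for r x
      by (rule cinner_ext) (simp add: cinner_scaleR_right c[symmetric])
    fix y
    have "(norm (Y y))\<^sup>2 = inner (X (Y y)) y" by (simp add: power2_norm_eq_inner Y)
    also have "\<dots> \<le> norm (X (Y y)) * norm y" by (rule norm_cauchy_schwarz)
    also have "\<dots> \<le> (norm X * norm (Y y)) * norm y"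
      by (intro mult_right_mono norm_blinfun) auto
    finally have "norm (Y y) * norm (Y y) \<le> norm (Y y) * (norm y * norm X)"
      by (simp add: power2_eq_square mult_ac)
    then show "norm (Y y) \<le> norm y * norm X"
      by (cases "Y y = 0") (auto dest: mult_left_le_imp_le)
  qed
  define Z where "Z = Blinfun Y"
  have Z: "blinfun_apply Z y = Y y" for y by (simp add: Z_def bounded_linear_Blinfun_apply[OF lin])
  show ?thesis
  proof (rule that[of Z])
    have "Y (a *\<^sub>C y) = a *\<^sub>C Y y" for a y
      by (rule cinner_ext) (simp add: cinner_scaleC_right c[symmetric])
    then show "Z \<in> BH" by (simp add: BH_def Z)
    show "cinner (X x) y = cinner x (Z y)" for x y by (simp add: Z c)
  qed
qed

lemma adj_eqI:
  fixes X Y :: "'h::chilbert_space \<Rightarrow>\<^sub>L 'h"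
  assumes "Y \<in> BH" "\<And>x y. cinner (X x) y = cinner x (Y y)"
  shows "adj X = Y"
  unfolding adj_def
proof (rule the_equality)
  fix Y' :: "'h \<Rightarrow>\<^sub>L 'h"
  assume "Y' \<in> BH \<and> (\<forall>x y. cinner (X x) y = cinner x (Y' y))"
  then have "Y' y = Y y" for y using assms by (intro cinner_ext) metis
  then show "Y' = Y" by (rule blinfun_eqI)
qed (use assms in blast)

lemma adj_BH [simp]: "X \<in> BH \<Longrightarrow> adj X \<in> BH"
  and cinner_adj: "X \<in> BH \<Longrightarrow> cinner (X x) y = cinner x (adj X y)"
  using ex_adjoint[of X] adj_eqI[of _ X] by metis+

lemma cinner_adj_left: "X \<in> BH \<Longrightarrow> cinner (adj X x) y = cinner x (X y)"
  by (metis cinner_adj cinner_commute)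

lemma adj_adj [simp]: "X \<in> BH \<Longrightarrow> adj (adj X) = X"
  by (rule adj_eqI) (auto simp: cinner_adj_left)

lemma norm_adj_le: "X \<in> BH \<Longrightarrow> norm (adj X) \<le> norm X"
proof (rule norm_blinfun_bound)
  fix y assume X: "X \<in> BH"
  have "(norm (adj X y))\<^sup>2 = Re (cinner (X (adj X y)) y)"
    by (simp add: X cinner_adj cinner_self)
  also have "\<dots> \<le> norm (X (adj X y)) * norm y"
    using cinner_Cauchy_Schwarz complex_Re_le_cmod order_trans by blast
  also have "\<dots> \<le> (norm X * norm (adj X y)) * norm y"
    by (intro mult_right_mono norm_blinfun) auto
  finally have "norm (adj X y) * norm (adj X y) \<le> norm (adj X y) * (norm X * norm y)"
    by (simp add: power2_eq_square mult_ac)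
  then show "norm (adj X y) \<le> norm X * norm y"
    by (cases "adj X y = 0") (auto dest: mult_left_le_imp_le)
qed simp

lemma BH_zero [simp]: "0 \<in> BH" by (simp add: BH_def)

lemma BH_add [simp]: "X \<in> BH \<Longrightarrow> Y \<in> BH \<Longrightarrow> X + Y \<in> BH"
  by (simp add: BH_def blinfun.add_left scaleC_add_right)

lemma BH_compose [simp]: "X \<in> BH \<Longrightarrow> Y \<in> BH \<Longrightarrow> X o\<^sub>L Y \<in> BH"
  by (simp add: BH_def)

lemma BH_sum [simp]: "(\<And>i. i \<in> I \<Longrightarrow> X i \<in> BH) \<Longrightarrow> (\<Sum>i\<in>I. X i) \<in> BH"
  by (induction I rule: infinite_finite_induct) auto

lemma scale_op_apply [simp]: "scale_op c X x = c *\<^sub>C X x"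
  by transfer simp

lemma BH_scale_op [simp]: "X \<in> BH \<Longrightarrow> scale_op c X \<in> BH"
  by (simp add: BH_def scaleC_scaleC mult.commute)

lemma adj_compose: "X \<in> BH \<Longrightarrow> Y \<in> BH \<Longrightarrow> adj (X o\<^sub>L Y) = adj Y o\<^sub>L adj X"
  by (rule adj_eqI) (simp_all add: cinner_adj)

lemma adj_sum:
  fixes X :: "'i \<Rightarrow> 'h::chilbert_space \<Rightarrow>\<^sub>L 'h"
  assumes "\<And>i. i \<in> I \<Longrightarrow> X i \<in> BH"
  shows "adj (\<Sum>i\<in>I. X i) = (\<Sum>i\<in>I. adj (X i))"
  using assms by (intro adj_eqI) (auto simp: blinfun.sum_left cinner_sum_left cinner_sum_right cinner_adj)

section \<open>Orthogonal series\<close>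

subclass (in chilbert_space) banach ..

definition orthonormal_seq :: "(nat \<Rightarrow> 'h::chilbert_space) \<Rightarrow> bool" where
  "orthonormal_seq u \<longleftrightarrow> (\<forall>i j. cinner (u i) (u j) = (if i = j then 1 else 0))"

definition orthogonal_seq :: "(nat \<Rightarrow> 'h::chilbert_space) \<Rightarrow> bool" where
  "orthogonal_seq y \<longleftrightarrow> (\<forall>i j. i \<noteq> j \<longrightarrow> cinner (y i) (y j) = 0)"

lemma orthonormal_seq_family: "orthonormal_seq u \<Longrightarrow> orthonormal_family u m"
  by (simp add: orthonormal_seq_def orthonormal_family_def)

lemma orthonormal_seq_orthogonal: "orthonormal_seq u \<Longrightarrow> orthogonal_seq u"
  by (simp add: orthonormal_seq_def orthogonal_seq_def)

lemma orthonormal_seq_norm: "orthonormal_seq u \<Longrightarrow> norm (u j) = 1"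
  using orthonormal_family_norm[OF orthonormal_seq_family, of u j "Suc j"] by simp

lemma orthonormal_basis_seq: "orthonormal_basis e \<Longrightarrow> orthonormal_seq e"
  by (simp add: orthonormal_basis_def orthonormal_seq_def)

lemma Bessel_summable:
  assumes "orthonormal_seq u"
  shows "summable (\<lambda>k. (cmod (cinner x (u k)))\<^sup>2)"
    and "(\<Sum>k. (cmod (cinner x (u k)))\<^sup>2) \<le> (norm x)\<^sup>2"
proof -
  have le: "(\<Sum>k<n. (cmod (cinner x (u k)))\<^sup>2) \<le> (norm x)\<^sup>2" for n
    unfolding norm_proj_square[OF orthonormal_seq_family[OF assms], symmetric]
    by (intro power_mono norm_proj_le orthonormal_seq_family assms) simp
  show s: "summable (\<lambda>k. (cmod (cinner x (u k)))\<^sup>2)"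
    by (rule summableI_nonneg_bounded[OF _ le]) simp
  show "(\<Sum>k. (cmod (cinner x (u k)))\<^sup>2) \<le> (norm x)\<^sup>2"
    by (rule suminf_le_const[OF s le])
qed

lemma norm_sum_orthogonal_square:
  assumes "orthogonal_seq y" "finite I"
  shows "(norm (\<Sum>k\<in>I. a k *\<^sub>C y k))\<^sup>2 = (\<Sum>k\<in>I. (cmod (a k))\<^sup>2 * (norm (y k))\<^sup>2)"
  using assms(2)
proof induction
  case (insert i I)
  have "cinner (a i *\<^sub>C y i) (\<Sum>k\<in>I. a k *\<^sub>C y k) = 0"
  proof -
    have "i \<noteq> k" if "k \<in> I" for k using that insert.hyps by blast
    then have "cinner (y i) (y k) = 0" if "k \<in> I" for k
      using that assms(1) by (simp add: orthogonal_seq_def)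
    then show ?thesis by (simp add: cinner_sum_right cinner_scaleC_left cinner_scaleC_right)
  qed
  then show ?case using insert
    by (simp add: norm_square_add_orthogonal norm_scaleC power_mult_distrib)
qed simp

text \<open>
  By Pythagoras the partial sums inherit the Cauchy property from the series of squared
  coefficients.
\<close>

lemma summable_orthogonal:
  assumes y: "orthogonal_seq y" and C: "\<And>k. norm (y k) \<le> C"
    and a: "summable (\<lambda>k. (cmod (a k))\<^sup>2)"
  shows "summable (\<lambda>k. a k *\<^sub>C y k)"
    and "norm (\<Sum>k. a k *\<^sub>C y k) \<le> C * sqrt (\<Sum>k. (cmod (a k))\<^sup>2)"
proof -
  have C0: "0 \<le> C" using C[of 0] norm_ge_zero order_trans by blast
  have le: "(norm (\<Sum>k\<in>I. a k *\<^sub>C y k))\<^sup>2 \<le> C\<^sup>2 * (\<Sum>k\<in>I. (cmod (a k))\<^sup>2)" if "finite I" for I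
    unfolding norm_sum_orthogonal_square[OF y that] sum_distrib_left
    by (intro sum_mono) (simp add: mult.commute[of "C\<^sup>2"] mult_left_mono power_mono C)
  show s: "summable (\<lambda>k. a k *\<^sub>C y k)"
    unfolding summable_Cauchy
  proof (intro allI impI)
    fix \<epsilon> :: real assume \<epsilon>: "\<epsilon> > 0"
    define \<delta> where "\<delta> = \<epsilon>\<^sup>2 / (C\<^sup>2 + 1)"
    have \<delta>: "\<delta> > 0" using \<epsilon> by (simp add: \<delta>_def add_nonneg_pos)
    have p: "0 < C\<^sup>2 + 1" by (simp add: add_nonneg_pos)
    obtain N where N: "\<And>m n. m \<ge> N \<Longrightarrow> norm (\<Sum>k=m..<n. (cmod (a k))\<^sup>2) < \<delta>"
      using a \<delta> unfolding summable_Cauchy by blast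
    have "norm (\<Sum>k=m..<n. a k *\<^sub>C y k) < \<epsilon>" if "m \<ge> N" for m n
    proof (rule power2_less_imp_less)
      have "(norm (\<Sum>k=m..<n. a k *\<^sub>C y k))\<^sup>2 \<le> C\<^sup>2 * (\<Sum>k=m..<n. (cmod (a k))\<^sup>2)"
        by (rule le) simp
      also have "\<dots> \<le> C\<^sup>2 * \<delta>"
        using N[OF that, of n] by (intro mult_left_mono) auto
      also have "\<dots> < (C\<^sup>2 + 1) * \<delta>" using \<delta> by simp
      also have "\<dots> = \<epsilon>\<^sup>2" using p by (simp add: \<delta>_def)
      finally show "(norm (\<Sum>k=m..<n. a k *\<^sub>C y k))\<^sup>2 < \<epsilon>\<^sup>2" .
    qed (use \<epsilon> in simp)
    then show "\<exists>N. \<forall>m\<ge>N. \<forall>n. norm (\<Sum>k=m..<n. a k *\<^sub>C y k) < \<epsilon>" by blast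
  qed
  show "norm (\<Sum>k. a k *\<^sub>C y k) \<le> C * sqrt (\<Sum>k. (cmod (a k))\<^sup>2)"
  proof (rule LIMSEQ_le_const2[OF tendsto_norm[OF summable_LIMSEQ[OF s]]], intro exI allI impI)
    fix n :: nat
    have "(norm (\<Sum>k<n. a k *\<^sub>C y k))\<^sup>2 \<le> C\<^sup>2 * (\<Sum>k<n. (cmod (a k))\<^sup>2)" by (rule le) simp
    also have "\<dots> \<le> C\<^sup>2 * (\<Sum>k. (cmod (a k))\<^sup>2)"
      by (intro mult_left_mono sum_le_suminf a) auto
    also have "\<dots> = (C * sqrt (\<Sum>k. (cmod (a k))\<^sup>2))\<^sup>2"
      by (simp add: power_mult_distrib suminf_nonneg[OF a])
    finally show "norm (\<Sum>k<n. a k *\<^sub>C y k) \<le> C * sqrt (\<Sum>k. (cmod (a k))\<^sup>2)"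
      by (rule power2_le_imp_le) (simp add: C0 suminf_nonneg[OF a])
  qed
qed

text \<open>
  The operator that sends \<open>u k\<close> to \<open>y k\<close> and vanishes on the orthogonal complement of \<open>u\<close>.
  Diagonal operators, partial isometries and square roots are all of this form.
\<close>

definition synthesis :: "(nat \<Rightarrow> 'h::chilbert_space) \<Rightarrow> (nat \<Rightarrow> 'h) \<Rightarrow> ('h \<Rightarrow>\<^sub>L 'h)" where
  "synthesis u y = Blinfun (\<lambda>x. \<Sum>k. cinner x (u k) *\<^sub>C y k)"

lemma
  assumes u: "orthonormal_seq u" and y: "orthogonal_seq y" and C: "\<And>k. norm (y k) \<le> C"
  shows synthesis_sums: "(\<lambda>k. cinner x (u k) *\<^sub>C y k) sums synthesis u y x"
    and synthesis_BH: "synthesis u y \<in> BH"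
    and synthesis_basis: "synthesis u y (u j) = y j"
proof -
  note s = summable_orthogonal[OF y C Bessel_summable(1)[OF u]]
  have C0: "0 \<le> C" using C[of 0] norm_ge_zero order_trans by blast
  have lin: "bounded_linear (\<lambda>x. \<Sum>k. cinner x (u k) *\<^sub>C y k)"
  proof (rule bounded_linear_intro[where K = C])
    fix x z
    show "(\<Sum>k. cinner (x + z) (u k) *\<^sub>C y k) =
        (\<Sum>k. cinner x (u k) *\<^sub>C y k) + (\<Sum>k. cinner z (u k) *\<^sub>C y k)"
      unfolding suminf_add[OF s(1) s(1)] by (simp add: cinner_add_left scaleC_add_left)
  next
    fix r x
    show "(\<Sum>k. cinner (r *\<^sub>R x) (u k) *\<^sub>C y k) = r *\<^sub>R (\<Sum>k. cinner x (u k) *\<^sub>C y k)"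
      unfolding suminf_scaleR_right[OF s(1)]
      by (intro arg_cong[where f = suminf] ext)
        (metis cinner_scaleR_left scaleC_of_real scaleC_scaleC)
  next
    fix x
    have "sqrt (\<Sum>k. (cmod (cinner x (u k)))\<^sup>2) \<le> norm x"
      using Bessel_summable(2)[OF u] by (simp add: real_le_lsqrt)
    then have "C * sqrt (\<Sum>k. (cmod (cinner x (u k)))\<^sup>2) \<le> norm x * C"
      using C0 by (simp add: mult.commute mult_left_mono)
    then show "norm (\<Sum>k. cinner x (u k) *\<^sub>C y k) \<le> norm x * C"
      using s(2)[of x] by linarith
  qed
  have ap: "synthesis u y x = (\<Sum>k. cinner x (u k) *\<^sub>C y k)" for x
    by (simp add: synthesis_def bounded_linear_Blinfun_apply[OF lin])
  show "(\<lambda>k. cinner x (u k) *\<^sub>C y k) sums synthesis u y x" for x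
    unfolding ap by (rule summable_sums[OF s(1)])
  show "synthesis u y \<in> BH"
  proof -
    have "synthesis u y (c *\<^sub>C x) = c *\<^sub>C synthesis u y x" for c x
      by (simp only: ap bounded_linear.suminf[OF bounded_linear_scaleC s(1)]
          cinner_scaleC_left scaleC_scaleC)
    then show ?thesis by (simp add: BH_def)
  qed
  show "synthesis u y (u j) = y j"
  proof -
    have "(\<lambda>k. cinner (u j) (u k) *\<^sub>C y k) = (\<lambda>k. if k = j then y k else 0)"
      using u by (auto simp: orthonormal_seq_def)
    then show ?thesis unfolding ap using sums_single[of j y] sums_unique by metis
  qed
qed

lemma cinner_suminf:
  assumes "z sums (s::'h::chilbert_space)"
  shows "(\<lambda>k. cinner (z k) x) sums cinner s x" "(\<lambda>k. cinner x (z k)) sums cinner x s"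
  using bounded_linear.sums[OF bounded_linear_cinner_left assms]
    bounded_linear.sums[OF bounded_linear_cinner_right assms] by auto

lemma orthogonal_residual:
  assumes u: "orthonormal_seq u"
  shows "cinner (x - synthesis u u x) (u j) = 0"
proof -
  have "(\<lambda>k. cinner (cinner x (u k) *\<^sub>C u k) (u j)) sums cinner (synthesis u u x) (u j)"
    using u by (intro cinner_suminf synthesis_sums[where C = 1] orthonormal_seq_orthogonal)
      (simp_all add: orthonormal_seq_norm[OF u])
  moreover have "(\<lambda>k. cinner (cinner x (u k) *\<^sub>C u k) (u j)) = (\<lambda>k. if k = j then cinner x (u k) else 0)"
    using u by (auto simp: cinner_scaleC_left orthonormal_seq_def)
  ultimately have "cinner (synthesis u u x) (u j) = cinner x (u j)"
    using sums_single[of j "\<lambda>k. cinner x (u k)"] sums_unique2 by metis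
  then show ?thesis by (simp add: cinner_diff_left)
qed

lemma orthonormal_basis_expansion:
  assumes "orthonormal_basis e"
  shows "(\<lambda>k. cinner x (e k) *\<^sub>C e k) sums x"
proof -
  note e = orthonormal_basis_seq[OF assms]
  have "x - synthesis e e x = 0"
    using assms orthogonal_residual[OF e, of x] unfolding orthonormal_basis_def by blast
  then have "synthesis e e x = x" by simp
  then show ?thesis
    using synthesis_sums[OF e orthonormal_seq_orthogonal[OF e], of 1 x]
    by (simp add: orthonormal_seq_norm[OF e])
qed

lemma Parseval:
  assumes "orthonormal_basis e"
  shows "(\<lambda>k. (cmod (cinner x (e k)))\<^sup>2) sums (norm x)\<^sup>2"
proof -
  have "cinner (cinner x (e k) *\<^sub>C e k) x = complex_of_real ((cmod (cinner x (e k)))\<^sup>2)" for k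
    by (simp only: cinner_scaleC_left complex_norm_square cinner_commute[of "e k" x])
  then show ?thesis
    using cinner_suminf(1)[OF orthonormal_basis_expansion[OF assms, of x], of x]
    by (simp only: cinner_self sums_of_real_iff)
qed

text \<open>
  If \<open>X\<close> and \<open>Y\<close> agree on a basis, then every vector in the range of the adjoint of their
  difference is orthogonal to that basis, hence 0.
\<close>

lemma BH_eqI_basis:
  assumes "orthonormal_basis e" "X \<in> BH" "Y \<in> BH" "\<And>k. X (e k) = Y (e k)"
  shows "X = Y"
proof (rule blinfun_eqI)
  fix x
  have "cinner (X x) y = cinner (Y x) y" for y
  proof -
    have "cinner (adj X y - adj Y y) (e k) = 0" for k
      using assms by (simp add: cinner_diff_left cinner_adj_left)
    then have "adj X y - adj Y y = 0" using assms(1) unfolding orthonormal_basis_def by blast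
    then show ?thesis using assms by (simp add: cinner_adj)
  qed
  then show "X x = Y x" by (metis cinner_commute cinner_ext)
qed

lemma diag_op_eqI:
  assumes "orthonormal_basis e" "D \<in> BH" "\<And>k. D (e k) = d k *\<^sub>C e k"
  shows "diag_op e d = D"
  unfolding diag_op_def
proof (rule the_equality)
  fix D' assume "D' \<in> BH \<and> (\<forall>k. D' (e k) = d k *\<^sub>C e k)"
  then show "D' = D" using assms by (intro BH_eqI_basis[OF assms(1)]) auto
qed (use assms in blast)

lemma adj_diagonal:
  assumes e: "orthonormal_basis e" and D: "D \<in> BH" "\<And>n. D (e n) = complex_of_real (d n) *\<^sub>C e n"
  shows "adj D (e n) = complex_of_real (d n) *\<^sub>C e n"
proof -
  have "cinner (adj D (e n) - complex_of_real (d n) *\<^sub>C e n) (e m) = 0" for m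
    using orthonormal_basis_seq[OF e] D
    by (simp add: cinner_simps cinner_adj_left orthonormal_seq_def)
  then show ?thesis using e unfolding orthonormal_basis_def by (metis right_minus_eq)
qed

section \<open>Extracting diagonal operators\<close>

text \<open>The vectors to which the \<open>n\<close>-th term of a greedily chosen sequence has to be orthogonal.\<close>

definition avoided :: "('h \<Rightarrow> 'h) \<Rightarrow> (nat \<Rightarrow> 'h) \<Rightarrow> nat \<Rightarrow> 'h set" where
  "avoided Q x n = (\<Union>j<n. {x j, Q (x j)})"

lemma finite_avoided [simp]: "finite (avoided Q x n)"
  by (simp add: avoided_def)

lemma card_avoided: "card (avoided Q x n) \<le> 2 * n"
proof -
  have "card (avoided Q x n) \<le> (\<Sum>j<n. card {x j, Q (x j)})"
    unfolding avoided_def by (rule card_UN_le) simp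
  also have "\<dots> \<le> (\<Sum>j<n. 2)" by (intro sum_mono) (simp add: card_insert_if)
  finally show ?thesis by simp
qed

lemma avoided_mono: "m \<le> n \<Longrightarrow> avoided Q x m \<subseteq> avoided Q x n"
  by (force simp: avoided_def)

text \<open>
  A choice principle: each new term may depend on all earlier terms and their images under \<open>Q\<close>.
  Below \<open>Q = Z\<^sup>* Z\<close>, which makes the images \<open>Z x\<^sub>n\<close> orthogonal, or \<open>Q = id\<close>.
\<close>

lemma greedy_sequence:
  assumes "\<And>V. finite V \<Longrightarrow> \<exists>x. R V x"
  obtains x :: "nat \<Rightarrow> 'h" where "\<And>n. R (avoided Q x n) (x n)"
proof -
  define nxt where "nxt V = (SOME x. R V x)" for V
  define V where "V = rec_nat {} (\<lambda>_ V. V \<union> {nxt V, Q (nxt V)})"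
  have V: "V 0 = {}" "V (Suc n) = V n \<union> {nxt (V n), Q (nxt (V n))}" for n
    by (simp_all add: V_def)
  have eq: "avoided Q (\<lambda>n. nxt (V n)) n = V n" for n
    by (induction n) (auto simp: V avoided_def lessThan_Suc)
  show ?thesis
  proof (rule that)
    fix n
    show "R (avoided Q (\<lambda>n. nxt (V n)) n) (nxt (V n))"
      unfolding eq nxt_def[of "V n"]
      by (rule someI_ex, rule assms, subst eq[symmetric]) simp
  qed
qed

text \<open>
  For a general bounded operator the supremum over the unit vectors need not be attained; the
  factor 2 makes up for this.
\<close>

lemma ex_nearly_norming_vector:
  fixes Z :: "'h::separable_infinite_dim_chilbert_space \<Rightarrow>\<^sub>L 'h"
  assumes "finite V"
  obtains x where "norm x = 1" "\<And>v. v \<in> V \<Longrightarrow> cinner x v = 0"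
    "\<And>y. (\<And>v. v \<in> V \<Longrightarrow> cinner y v = 0) \<Longrightarrow> norm (Z y) \<le> 2 * norm (Z x) * norm y"
proof -
  define U where "U = {x. norm x = 1 \<and> (\<forall>v\<in>V. cinner x v = 0)}"
  define s where "s = (SUP x\<in>U. norm (Z x))"
  obtain u where "norm u = 1" "\<And>v. v \<in> V \<Longrightarrow> cinner u v = 0"
    using ex_unit_vector_orthogonal[OF assms] by blast
  then have u: "u \<in> U" by (simp add: U_def)
  have bdd: "bdd_above ((\<lambda>x. norm (Z x)) ` U)"
  proof (rule bdd_aboveI2)
    fix x assume "x \<in> U"
    then show "norm (Z x) \<le> norm Z" using norm_blinfun[of Z x] by (simp add: U_def)
  qed
  have le: "norm (Z y) \<le> s * norm y" if "\<And>v. v \<in> V \<Longrightarrow> cinner y v = 0" for y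
  proof (cases "y = 0")
    case False
    have "inverse (norm y) *\<^sub>R y \<in> U"
      using that False by (simp add: U_def cinner_scaleR_left)
    then have "norm (Z (inverse (norm y) *\<^sub>R y)) \<le> s"
      unfolding s_def by (rule cSUP_upper[OF _ bdd])
    then show ?thesis using False by (simp add: blinfun.scaleR_right field_simps)
  qed simp
  have s0: "0 \<le> s" using cSUP_upper[OF u bdd] norm_ge_zero[of "Z u"] unfolding s_def by linarith
  have "\<exists>x\<in>U. s \<le> 2 * norm (Z x)"
  proof (cases "s = 0")
    case False
    then have "s / 2 < s" using s0 by simp
    then obtain x where "x \<in> U" "s / 2 < norm (Z x)"
      using u less_cSUP_iff[OF _ bdd, of "s / 2"] unfolding s_def by blast
    then show ?thesis by (intro bexI[of _ x]) auto
  qed (use u in auto)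
  then obtain x where x: "x \<in> U" "s \<le> 2 * norm (Z x)" by blast
  show ?thesis
  proof (rule that[of x])
    fix y assume "\<And>v. v \<in> V \<Longrightarrow> cinner y v = 0"
    from le[OF this] x(2) show "norm (Z y) \<le> 2 * norm (Z x) * norm y"
      by (metis mult_right_mono norm_ge_zero order_trans)
  qed (use x(1) in \<open>auto simp: U_def\<close>)
qed

lemma greedy_orthonormal:
  assumes x: "\<And>n. norm (x n) = 1" "\<And>n v. v \<in> avoided Q x n \<Longrightarrow> cinner (x n) v = 0"
  shows "orthonormal_seq (x :: nat \<Rightarrow> 'h::chilbert_space)"
proof -
  have lt: "cinner (x i) (x j) = 0" if "j < i" for i j
    using x(2)[of "x j" i] that by (auto simp: avoided_def)
  have "cinner (x i) (x j) = 0" if "i \<noteq> j" for i j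
    using lt[of i j] lt[of j i] that by (metis cinner_commute complex_cnj_zero linorder_neqE_nat)
  then show ?thesis using x(1) by (simp add: orthonormal_seq_def cinner_self)
qed

lemma greedy_image_orthogonal:
  assumes Z: "Z \<in> BH"
    and x: "\<And>n v. v \<in> avoided (\<lambda>y. adj Z (Z y)) x n \<Longrightarrow> cinner (x n) v = 0"
  shows "orthogonal_seq (\<lambda>n. Z (x n :: 'h::chilbert_space))"
proof -
  have lt: "cinner (Z (x i)) (Z (x j)) = 0" if "j < i" for i j
    using x[of "adj Z (Z (x j))" i] that Z by (auto simp: avoided_def cinner_adj)
  show ?thesis unfolding orthogonal_seq_def
    using lt by (metis cinner_commute complex_cnj_zero linorder_neqE_nat)
qed

text \<open>
  Together the next two predicates say that off a subspace of dimension at most \<open>K n\<close> the operator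
  \<open>Z\<close> is bounded by \<open>2 d n\<close>, that is, that \<open>d\<close> controls the singular numbers of \<open>Z\<close>. The
  subspaces are kept because several operators and a basis have to be controlled by one subspace.
\<close>

definition sparse_constraints :: "nat \<Rightarrow> (nat \<Rightarrow> real) \<Rightarrow> (nat \<Rightarrow> 'h::chilbert_space set) \<Rightarrow> bool" where
  "sparse_constraints K d V \<longleftrightarrow> (\<forall>n. 0 \<le> d n) \<and> (\<forall>m n. n \<le> m \<longrightarrow> d m \<le> 2 * d n) \<and>
     (\<forall>n. finite (V n) \<and> card (V n) \<le> K * n)"

definition dominated_off ::
  "(nat \<Rightarrow> 'h::chilbert_space set) \<Rightarrow> (nat \<Rightarrow> real) \<Rightarrow> ('h \<Rightarrow>\<^sub>L 'h) \<Rightarrow> bool" where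
  "dominated_off V d Z \<longleftrightarrow>
     (\<forall>n y. (\<forall>v\<in>V n. cinner y v = 0) \<longrightarrow> norm (Z y) \<le> 2 * d n * norm y)"

lemma sparse_constraints_join:
  assumes "sparse_constraints K d V" "sparse_constraints K' d' V'"
  shows "sparse_constraints (K + K') (\<lambda>n. d n + d' n) (\<lambda>n. V n \<union> V' n)"
  unfolding sparse_constraints_def
proof (intro conjI allI impI)
  fix m n :: nat
  show "0 \<le> d n + d' n" "finite (V n \<union> V' n)"
    using assms by (auto simp: sparse_constraints_def)
  show "card (V n \<union> V' n) \<le> (K + K') * n"
    using assms order_trans[OF card_Un_le[of "V n" "V' n"]]
    by (simp add: sparse_constraints_def add_mono distrib_right)
  assume "n \<le> m"
  then have "d m \<le> 2 * d n" "d' m \<le> 2 * d' n" using assms by (auto simp: sparse_constraints_def)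
  then show "d m + d' m \<le> 2 * (d n + d' n)" by simp
qed

lemma dominated_off_mono:
  assumes "dominated_off V d Z" "\<And>n. V n \<subseteq> V' n" "\<And>n. d n \<le> d' n"
  shows "dominated_off V' d' Z"
  unfolding dominated_off_def
proof (intro allI impI)
  fix n y assume "\<forall>v\<in>V' n. cinner y v = 0"
  then have "norm (Z y) \<le> 2 * d n * norm y"
    using assms(1,2) unfolding dominated_off_def by blast
  also have "\<dots> \<le> 2 * d' n * norm y" using assms(3) by (intro mult_right_mono) simp_all
  finally show "norm (Z y) \<le> 2 * d' n * norm y" .
qed

text \<open>
  Choose unit vectors \<open>x\<^sub>n\<close> greedily, each orthogonal to the earlier \<open>x\<^sub>j\<close> and
  \<open>Z\<^sup>* Z x\<^sub>j\<close> and, subject to this, with \<open>\<parallel>Z x\<^sub>n\<parallel>\<close> nearly maximal. Both \<open>x\<^sub>n\<close> and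
  \<open>Z x\<^sub>n\<close> are orthogonal sequences, so contractions \<open>U\<close> and \<open>W\<close> with \<open>U e\<^sub>n = x\<^sub>n\<close>
  and \<open>W Z x\<^sub>n = \<parallel>Z x\<^sub>n\<parallel> e\<^sub>n\<close> exist. This replaces the singular value decomposition and
  works for operators that are not compact.
\<close>

lemma diagonal_compression:
  fixes Z :: "'h::separable_infinite_dim_chilbert_space \<Rightarrow>\<^sub>L 'h"
  assumes e: "orthonormal_basis e" and Z: "Z \<in> BH"
  obtains U W d V where "U \<in> BH" "W \<in> BH"
    "\<forall>n. W (Z (U (e n))) = complex_of_real (d n) *\<^sub>C e n"
    "sparse_constraints 2 d V" "dominated_off V d Z"
proof -
  define Q where "Q y = adj Z (Z y)" for y
  obtain x where x: "\<And>n. norm (x n) = 1" "\<And>n v. v \<in> avoided Q x n \<Longrightarrow> cinner (x n) v = 0"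
    and le: "\<And>n y. (\<And>v. v \<in> avoided Q x n \<Longrightarrow> cinner y v = 0) \<Longrightarrow>
       norm (Z y) \<le> 2 * norm (Z (x n)) * norm y"
  proof -
    let ?R = "\<lambda>V x. norm x = 1 \<and> (\<forall>v\<in>V. cinner x v = 0) \<and>
      (\<forall>y. (\<forall>v\<in>V. cinner y v = 0) \<longrightarrow> norm (Z y) \<le> 2 * norm (Z x) * norm y)"
    have "\<exists>x. ?R V x" if "finite V" for V
      using ex_nearly_norming_vector[OF that, of Z] by metis
    from greedy_sequence[of ?R Q, OF this] show ?thesis using that by metis
  qed
  have on: "orthonormal_seq x" by (rule greedy_orthonormal[OF x])
  have og: "orthogonal_seq (\<lambda>n. Z (x n))"
    by (rule greedy_image_orthogonal[OF Z]) (use x(2) in \<open>simp add: Q_def[abs_def]\<close>)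
  define d where "d n = norm (Z (x n))" for n
  define y where "y n = inverse (complex_of_real (d n)) *\<^sub>C Z (x n)" for n
  have y: "orthogonal_seq y"
    using og by (auto simp: orthogonal_seq_def y_def cinner_simps)
  have y1: "norm (y n) \<le> 1" for n
    by (cases "d n = 0") (auto simp: y_def norm_scaleC norm_inverse d_def)
  note es = orthonormal_basis_seq[OF e]
  define U where "U = synthesis e x"
  define Y where "Y = synthesis e y"
  have x1: "norm (x n) \<le> 1" for n using x(1) by simp
  have U: "U \<in> BH" "U (e n) = x n" for n
    using synthesis_BH[OF es orthonormal_seq_orthogonal[OF on] x1]
      synthesis_basis[OF es orthonormal_seq_orthogonal[OF on] x1] by (auto simp: U_def)
  have Y: "Y \<in> BH" "Y (e n) = y n" for n
    using synthesis_BH[OF es y y1] synthesis_basis[OF es y y1] by (auto simp: Y_def)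
  show ?thesis
  proof (rule that[of U "adj Y" d "avoided Q x"])
    have "cinner (adj Y (Z (U (e n))) - complex_of_real (d n) *\<^sub>C e n) (e m) = 0" for n m
    proof (cases "n = m")
      case True
      have "cinner (Z (x n)) (y n) = complex_of_real (d n)"
        by (cases "d n = 0") (auto simp: y_def cinner_scaleC_right cinner_self power2_eq_square d_def)
      then show ?thesis using es True Y U
        by (simp add: cinner_simps cinner_adj_left orthonormal_seq_def)
    next
      case False
      have "cinner (Z (x n)) (y m) = 0"
        using og False by (simp add: y_def cinner_scaleC_right orthogonal_seq_def)
      then show ?thesis using es False Y U
        by (simp add: cinner_simps cinner_adj_left orthonormal_seq_def)
    qed
    then show "\<forall>n. adj Y (Z (U (e n))) = complex_of_real (d n) *\<^sub>C e n"
      using e unfolding orthonormal_basis_def by (metis right_minus_eq)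
  next
    have "d m \<le> 2 * d n" if "n \<le> m" for m n
    proof -
      have "norm (Z (x m)) \<le> 2 * norm (Z (x n)) * norm (x m)"
        using avoided_mono[OF that, of Q x] x(2) by (intro le) blast
      then show ?thesis by (simp add: d_def x(1))
    qed
    then show "sparse_constraints 2 d (avoided Q x)"
      by (simp add: sparse_constraints_def card_avoided d_def)
    show "dominated_off (avoided Q x) d Z"
      using le by (simp add: dominated_off_def d_def)
  qed (use U Y in auto)
qed

section \<open>Two-sided ideals\<close>

lemma
  assumes "two_sided_ideal I"
  shows ideal_BH: "X \<in> I \<Longrightarrow> X \<in> BH"
    and ideal_zero: "0 \<in> I"
    and ideal_add: "X \<in> I \<Longrightarrow> Y \<in> I \<Longrightarrow> X + Y \<in> I"
    and ideal_scale: "X \<in> I \<Longrightarrow> scale_op c X \<in> I"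
    and ideal_right: "X \<in> I \<Longrightarrow> Y \<in> BH \<Longrightarrow> X o\<^sub>L Y \<in> I"
    and ideal_left: "X \<in> I \<Longrightarrow> Y \<in> BH \<Longrightarrow> Y o\<^sub>L X \<in> I"
  using assms unfolding two_sided_ideal_def by auto

lemma ideal_sum_mem:
  "two_sided_ideal J \<Longrightarrow> (\<And>i. i \<in> I \<Longrightarrow> X i \<in> J) \<Longrightarrow> (\<Sum>i\<in>I. X i) \<in> J"
  by (induction I rule: infinite_finite_induct) (auto simp: ideal_zero ideal_add)

lemma scale_op_sum: "scale_op c (\<Sum>i\<in>I. X i) = (\<Sum>i\<in>I. scale_op c (X i))"
  by (rule blinfun_eqI) (simp add: blinfun.sum_left scaleC_sum_right)

lemma compose_sum_right: "Z o\<^sub>L (\<Sum>i\<in>I. X i) = (\<Sum>i\<in>I. Z o\<^sub>L X i)"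
  by (rule blinfun_eqI) (simp add: blinfun.sum_left blinfun.sum_right)

lemma compose_sum_left: "(\<Sum>i\<in>I. X i) o\<^sub>L Z = (\<Sum>i\<in>I. X i o\<^sub>L Z)"
  by (rule blinfun_eqI) (simp add: blinfun.sum_left)

lemma two_sided_ideal_BH: "two_sided_ideal BH"
  by (simp add: two_sided_ideal_def)

lemma two_sided_ideal_principal:
  assumes "X \<in> BH"
  shows "two_sided_ideal (principal_ideal X)"
proof -
  have "principal_ideal X \<subseteq> BH"
    using assms two_sided_ideal_BH by (auto simp: principal_ideal_def)
  then show ?thesis
    unfolding two_sided_ideal_def
    by (auto simp: principal_ideal_def ideal_zero ideal_add ideal_scale ideal_right ideal_left)
qed

lemma principal_ideal_self: "X \<in> principal_ideal X"
  by (simp add: principal_ideal_def)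

lemma two_sided_ideal_Int:
  "two_sided_ideal I \<Longrightarrow> two_sided_ideal J \<Longrightarrow> two_sided_ideal (I \<inter> J)"
  unfolding two_sided_ideal_def by blast

lemma sum_append:
  fixes f g :: "nat \<Rightarrow> 'a::comm_monoid_add"
  shows "(\<Sum>k<m + n. if k < m then f k else g (k - m)) = (\<Sum>k<m. f k) + (\<Sum>k<n. g k)"
  by (induction n) (simp_all add: add.assoc)

lemma ideal_prod_sumI:
  "(\<And>k. k < m \<Longrightarrow> X k \<in> M) \<Longrightarrow> (\<And>k. k < m \<Longrightarrow> Y k \<in> N) \<Longrightarrow>
    (\<Sum>k<(m::nat). scale_op (c k) (X k o\<^sub>L Y k)) \<in> ideal_prod M N"
  unfolding ideal_prod_def by blast

lemma two_sided_ideal_prod: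
  fixes M N :: "('h::chilbert_space \<Rightarrow>\<^sub>L 'h) set"
  assumes M: "two_sided_ideal M" and N: "two_sided_ideal N"
  shows "two_sided_ideal (ideal_prod M N)"
  unfolding two_sided_ideal_def
proof (intro conjI ballI allI)
  show "ideal_prod M N \<subseteq> BH"
    using ideal_BH[OF M] ideal_BH[OF N]
    by (auto simp: ideal_prod_def intro!: BH_sum BH_scale_op BH_compose)
  show "0 \<in> ideal_prod M N"
    unfolding ideal_prod_def by (simp, intro exI[of _ 0]) simp
next
  fix P P' assume "P \<in> ideal_prod M N" "P' \<in> ideal_prod M N"
  then obtain m m' :: nat and c c' X X' Y Y'
    where P: "P = (\<Sum>k<m. scale_op (c k) (X k o\<^sub>L Y k))" "\<And>k. k < m \<Longrightarrow> X k \<in> M \<and> Y k \<in> N"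
      and P': "P' = (\<Sum>k<m'. scale_op (c' k) (X' k o\<^sub>L Y' k))" "\<And>k. k < m' \<Longrightarrow> X' k \<in> M \<and> Y' k \<in> N"
    unfolding ideal_prod_def by blast
  let ?join = "\<lambda>f g k. if k < m then f k else g (k - m)"
  have "P + P' = (\<Sum>k<m + m'. scale_op (?join c c' k) (?join X X' k o\<^sub>L ?join Y Y' k))"
    unfolding P(1) P'(1) sum_append[symmetric] by (intro sum.cong) auto
  moreover have "\<forall>k<m + m'. ?join X X' k \<in> M \<and> ?join Y Y' k \<in> N"
    using P(2) P'(2) by auto
  ultimately show "P + P' \<in> ideal_prod M N"
    by (simp only:) (rule ideal_prod_sumI, blast+)
next
  fix s P assume "P \<in> ideal_prod M N"
  then obtain m :: nat and c X Y
    where P: "P = (\<Sum>k<m. scale_op (c k) (X k o\<^sub>L Y k))" "\<forall>k<m. X k \<in> M \<and> Y k \<in> N"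
    unfolding ideal_prod_def by blast
  have "scale_op s (scale_op a Z) = scale_op (s * a) Z" for a and Z :: "'h \<Rightarrow>\<^sub>L 'h"
    by (rule blinfun_eqI) (simp add: scaleC_scaleC)
  then have "scale_op s P = (\<Sum>k<m. scale_op (s * c k) (X k o\<^sub>L Y k))"
    by (simp add: P(1) scale_op_sum)
  then show "scale_op s P \<in> ideal_prod M N" using P(2) by (simp add: ideal_prod_sumI)
next
  fix P and Z :: "'h \<Rightarrow>\<^sub>L 'h" assume "P \<in> ideal_prod M N" and Z: "Z \<in> BH"
  then obtain m :: nat and c X Y
    where P: "P = (\<Sum>k<m. scale_op (c k) (X k o\<^sub>L Y k))" "\<forall>k<m. X k \<in> M \<and> Y k \<in> N"
    unfolding ideal_prod_def by blast
  have "scale_op a (R o\<^sub>L R') o\<^sub>L Z = scale_op a (R o\<^sub>L (R' o\<^sub>L Z))"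
    "Z o\<^sub>L scale_op a (R o\<^sub>L R') = scale_op a ((Z o\<^sub>L R) o\<^sub>L R')" for a and R R' :: "'h \<Rightarrow>\<^sub>L 'h"
    by (rule blinfun_eqI, simp add: BH_scaleC[OF Z])+
  then have "P o\<^sub>L Z = (\<Sum>k<m. scale_op (c k) (X k o\<^sub>L (Y k o\<^sub>L Z)))"
    "Z o\<^sub>L P = (\<Sum>k<m. scale_op (c k) ((Z o\<^sub>L X k) o\<^sub>L Y k))"
    by (simp_all add: P(1) compose_sum_left compose_sum_right)
  moreover have "\<forall>k<m. X k \<in> M \<and> (Y k o\<^sub>L Z) \<in> N" "\<forall>k<m. (Z o\<^sub>L X k) \<in> M \<and> Y k \<in> N"
    using P(2) Z ideal_right[OF N] ideal_left[OF M] by auto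
  ultimately show "P o\<^sub>L Z \<in> ideal_prod M N" "Z o\<^sub>L P \<in> ideal_prod M N"
    by (simp_all add: ideal_prod_sumI)
qed

lemma ideal_prod_mem:
  assumes "X \<in> M" "Y \<in> N"
  shows "X o\<^sub>L Y \<in> ideal_prod M N"
proof -
  have "X o\<^sub>L Y = (\<Sum>k<(1::nat). scale_op 1 (X o\<^sub>L Y))" by (rule blinfun_eqI) simp
  also have "\<dots> \<in> ideal_prod M N" using assms by (intro ideal_prod_sumI)
  finally show ?thesis .
qed

lemma two_sided_ideal_sum:
  fixes I :: "nat \<Rightarrow> ('h::chilbert_space \<Rightarrow>\<^sub>L 'h) set"
  assumes I: "\<And>i. i \<in> {1..n} \<Longrightarrow> two_sided_ideal (I i)"
  shows "two_sided_ideal (ideal_sum n I)"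
  unfolding two_sided_ideal_def
proof (intro conjI ballI allI)
  show "ideal_sum n I \<subseteq> BH"
    using ideal_BH[OF I] by (auto simp: ideal_sum_def intro!: BH_sum)
  show "0 \<in> ideal_sum n I"
    unfolding ideal_sum_def using ideal_zero[OF I] by (simp, intro exI[of _ "\<lambda>_. 0"]) simp
next
  fix P P' assume "P \<in> ideal_sum n I" "P' \<in> ideal_sum n I"
  then obtain X X' where "P = sum X {1..n}" "P' = sum X' {1..n}"
    "\<forall>i\<in>{1..n}. X i \<in> I i" "\<forall>i\<in>{1..n}. X' i \<in> I i"
    unfolding ideal_sum_def by blast
  then show "P + P' \<in> ideal_sum n I"
    unfolding ideal_sum_def mem_Collect_eq using ideal_add[OF I]
    by (intro exI[of _ "\<lambda>i. X i + X' i"]) (auto simp: sum.distrib)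
next
  fix s P assume "P \<in> ideal_sum n I"
  then obtain X where "P = sum X {1..n}" "\<forall>i\<in>{1..n}. X i \<in> I i"
    unfolding ideal_sum_def by blast
  then show "scale_op s P \<in> ideal_sum n I"
    unfolding ideal_sum_def mem_Collect_eq using ideal_scale[OF I]
    by (intro exI[of _ "\<lambda>i. scale_op s (X i)"]) (auto simp: scale_op_sum)
next
  fix P and Z :: "'h \<Rightarrow>\<^sub>L 'h" assume "P \<in> ideal_sum n I" and Z: "Z \<in> BH"
  then obtain X where X: "P = sum X {1..n}" "\<forall>i\<in>{1..n}. X i \<in> I i"
    unfolding ideal_sum_def by blast
  show "P o\<^sub>L Z \<in> ideal_sum n I"
    unfolding ideal_sum_def mem_Collect_eq using ideal_right[OF I] X Z
    by (intro exI[of _ "\<lambda>i. X i o\<^sub>L Z"]) (auto simp: compose_sum_left)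
  show "Z o\<^sub>L P \<in> ideal_sum n I"
    unfolding ideal_sum_def mem_Collect_eq using ideal_left[OF I] X Z
    by (intro exI[of _ "\<lambda>i. Z o\<^sub>L X i"]) (auto simp: compose_sum_right)
qed

lemma ideal_sum_memI: "(\<And>i. i \<in> {1..n} \<Longrightarrow> X i \<in> I i) \<Longrightarrow> (\<Sum>i=1..n. X i) \<in> ideal_sum n I"
  unfolding ideal_sum_def by blast

text \<open>
  The operator \<open>A i T B i\<close> belongs to the \<open>i\<close>-th summand of each of the three sums of ideals that
  are intersected, so \<open>\<Delta>(T)\<close> belongs to the intersection.
\<close>

lemma
  fixes A B :: "nat \<Rightarrow> ('h::chilbert_space \<Rightarrow>\<^sub>L 'h)"
  assumes A: "\<And>i. i \<in> {1..n} \<Longrightarrow> A i \<in> BH" and B: "\<And>i. i \<in> {1..n} \<Longrightarrow> B i \<in> BH" and T: "T \<in> BH"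
  shows two_sided_ideal_S_ideal: "two_sided_ideal (S_ideal n A B T)"
    and elem_op_in_S_ideal: "elem_op n A B T \<in> S_ideal n A B T"
proof -
  show "two_sided_ideal (S_ideal n A B T)"
    unfolding S_ideal_def using assms
    by (intro two_sided_ideal_Int two_sided_ideal_sum two_sided_ideal_prod two_sided_ideal_principal)
      auto
  have comp_assoc: "(X o\<^sub>L Y) o\<^sub>L Z = X o\<^sub>L (Y o\<^sub>L Z)" for X Y Z :: "'h \<Rightarrow>\<^sub>L 'h"
    by (rule blinfun_eqI) simp
  have "A i o\<^sub>L T o\<^sub>L B i \<in> principal_ideal (A i o\<^sub>L T o\<^sub>L B i)"
    "A i o\<^sub>L T o\<^sub>L B i \<in> ideal_prod (principal_ideal (A i o\<^sub>L T)) (principal_ideal (B i))"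
    "A i o\<^sub>L T o\<^sub>L B i \<in> ideal_prod (principal_ideal (A i)) (principal_ideal (T o\<^sub>L B i))" for i
    using ideal_prod_mem[OF principal_ideal_self principal_ideal_self, of "A i o\<^sub>L T" "B i"]
      ideal_prod_mem[OF principal_ideal_self principal_ideal_self, of "A i" "T o\<^sub>L B i"]
    by (simp_all add: principal_ideal_self comp_assoc)
  then show "elem_op n A B T \<in> S_ideal n A B T"
    unfolding S_ideal_def elem_op_def by (intro IntI ideal_sum_memI)
qed

section \<open>Ideals that do not contain the harmonic diagonal\<close>

text \<open>
  The lower bound \<open>c / n \<le> \<delta> n\<close> for large \<open>n\<close> and the near monotonicity of \<open>\<delta>\<close>, which
  covers the remaining indices, bound the quotient of the two diagonals. So the harmonic diagonal is
  a bounded diagonal operator times \<open>D\<close>.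
\<close>

lemma omega_in_ideal:
  assumes e: "orthonormal_basis e" and S: "two_sided_ideal S"
    and D: "D \<in> S" "\<And>n. D (e n) = complex_of_real (\<delta> n) *\<^sub>C e n"
    and mono: "\<And>m n. n \<le> m \<Longrightarrow> \<delta> m \<le> 2 * \<delta> n"
    and c: "c > 0" "\<And>n. n \<ge> N \<Longrightarrow> c \<le> real n * \<delta> n"
  shows "diag_op e omega \<in> S"
proof -
  note es = orthonormal_basis_seq[OF e]
  define M where "M = max N 1"
  have M: "real M * \<delta> M \<ge> c" "M \<ge> 1" using c(2)[of M] by (auto simp: M_def)
  then have \<delta>M: "\<delta> M > 0" using c(1) by (smt (verit) mult_nonneg_nonpos of_nat_0_le_iff)
  define C where "C = max (1 / c) (2 / \<delta> M)"
  have pos: "\<delta> n > 0 \<and> 1 / real (n + 1) \<le> C * \<delta> n" for n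
  proof (cases "n \<ge> M")
    case True
    then have n: "c \<le> real n * \<delta> n" "n \<ge> 1" using c(2)[of n] by (auto simp: M_def)
    then have "\<delta> n > 0" using c(1) by (smt (verit) mult_nonneg_nonpos of_nat_0_le_iff)
    moreover have "1 / real (n + 1) \<le> 1 / real n" using n(2) by (simp add: frac_le)
    moreover have "1 / real n \<le> (1 / c) * \<delta> n" using n c(1) by (simp add: field_simps)
    moreover have "(1 / c) * \<delta> n \<le> C * \<delta> n"
      using \<open>\<delta> n > 0\<close> by (intro mult_right_mono) (auto simp: C_def)
    ultimately show ?thesis by linarith
  next
    case False
    then have n: "\<delta> M \<le> 2 * \<delta> n" by (intro mono) simp
    then have "\<delta> n > 0" using \<delta>M by linarith
    moreover have "1 / real (n + 1) \<le> 1" by simp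
    moreover have "1 \<le> (2 / \<delta> M) * \<delta> n" using n \<delta>M by (simp add: field_simps)
    moreover have "(2 / \<delta> M) * \<delta> n \<le> C * \<delta> n"
      using \<open>\<delta> n > 0\<close> by (intro mult_right_mono) (auto simp: C_def)
    ultimately show ?thesis by linarith
  qed
  define y where "y n = complex_of_real (1 / (real (n + 1) * \<delta> n)) *\<^sub>C e n" for n
  have y: "orthogonal_seq y"
    using orthonormal_seq_orthogonal[OF es] by (simp add: orthogonal_seq_def y_def cinner_simps)
  have yC: "norm (y n) \<le> C" for n
    using pos[of n] orthonormal_seq_norm[OF es, of n]
    by (simp add: y_def norm_scaleC field_simps norm_divide norm_mult del: of_nat_Suc of_nat_add)
  define R where "R = synthesis e y"
  have R: "R \<in> BH" "\<And>n. R (e n) = y n"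
    using synthesis_BH[OF es y yC] synthesis_basis[OF es y yC] by (simp_all add: R_def)
  have "diag_op e omega = R o\<^sub>L D"
  proof (rule diag_op_eqI[OF e])
    show "R o\<^sub>L D \<in> BH" using R(1) ideal_BH[OF S D(1)] by simp
    fix n
    have "complex_of_real (\<delta> n) * complex_of_real (1 / (real (n + 1) * \<delta> n)) = omega n"
      using pos[of n] by (simp add: omega_def)
    then show "(R o\<^sub>L D) (e n) = omega n *\<^sub>C e n"
      using D(2)[of n] by (simp add: R BH_scaleC[OF R(1)] y_def scaleC_scaleC)
  qed
  also have "\<dots> \<in> S" using ideal_left[OF S D(1) R(1)] .
  finally show ?thesis .
qed

text \<open>
  The diagonals extracted from \<open>Z\<close> and from \<open>adj Z\<close> are added, so that one diagonal in the ideal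
  controls both operators.
\<close>

lemma ideal_diagonal:
  fixes Z :: "'h::separable_infinite_dim_chilbert_space \<Rightarrow>\<^sub>L 'h"
  assumes e: "orthonormal_basis e" and S: "two_sided_ideal S" and Z: "Z \<in> S"
  obtains D d V where "D \<in> S" "\<forall>n. D (e n) = complex_of_real (d n) *\<^sub>C e n"
    "sparse_constraints 4 d V" "dominated_off V d Z" "dominated_off V d (adj Z)"
proof -
  have ZB: "Z \<in> BH" using ideal_BH[OF S Z] .
  obtain U W d V where UW: "U \<in> BH" "W \<in> BH"
    and d: "\<forall>n. W (Z (U (e n))) = complex_of_real (d n) *\<^sub>C e n"
    and V: "sparse_constraints 2 d V" "dominated_off V d Z"
    using diagonal_compression[OF e ZB] by blast
  obtain U' W' d' V' where UW': "U' \<in> BH" "W' \<in> BH"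
    and d': "\<forall>n. W' (adj Z (U' (e n))) = complex_of_real (d' n) *\<^sub>C e n"
    and V': "sparse_constraints 2 d' V'" "dominated_off V' d' (adj Z)"
    using diagonal_compression[OF e adj_BH[OF ZB]] by blast
  define D' where "D' = W' o\<^sub>L (adj Z o\<^sub>L U')"
  \<comment> \<open>The adjoint of a compression of \<open>adj Z\<close> to a diagonal is a compression of \<open>Z\<close> itself,
    and it is the same diagonal because the entries are real.\<close>
  have "adj D' = (adj U' o\<^sub>L Z) o\<^sub>L adj W'"
    using UW' ZB by (simp add: D'_def adj_compose)
  then have D'S: "adj D' \<in> S"
    using UW' by (simp add: ideal_left[OF S] ideal_right[OF S] Z)
  have D': "adj D' (e n) = complex_of_real (d' n) *\<^sub>C e n" for n
    by (rule adj_diagonal[OF e]) (use UW' ZB d' in \<open>simp_all add: D'_def\<close>)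
  show ?thesis
  proof (rule that)
    show "(W o\<^sub>L (Z o\<^sub>L U)) + adj D' \<in> S"
      by (intro ideal_add[OF S] D'S ideal_left[OF S] ideal_right[OF S] Z UW)
    show "\<forall>n. ((W o\<^sub>L (Z o\<^sub>L U)) + adj D') (e n) = complex_of_real (d n + d' n) *\<^sub>C e n"
      by (simp add: blinfun.add_left d D' scaleC_add_left)
    show "sparse_constraints 4 (\<lambda>n. d n + d' n) (\<lambda>n. V n \<union> V' n)"
      using sparse_constraints_join[OF V(1) V'(1)] by simp
    show "dominated_off (\<lambda>n. V n \<union> V' n) (\<lambda>n. d n + d' n) Z"
      using V(2) by (rule dominated_off_mono) (use V'(1) in \<open>auto simp: sparse_constraints_def\<close>)
    show "dominated_off (\<lambda>n. V n \<union> V' n) (\<lambda>n. d n + d' n) (adj Z)"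
      using V'(2) by (rule dominated_off_mono) (use V(1) in \<open>auto simp: sparse_constraints_def\<close>)
  qed
qed

lemma ideal_common_diagonal:
  fixes Z :: "'i \<Rightarrow> 'h::separable_infinite_dim_chilbert_space \<Rightarrow>\<^sub>L 'h"
  assumes e: "orthonormal_basis e" and S: "two_sided_ideal S"
    and I: "finite I" and Z: "\<And>i. i \<in> I \<Longrightarrow> Z i \<in> S"
  shows "\<exists>D d V. D \<in> S \<and> (\<forall>n. D (e n) = complex_of_real (d n) *\<^sub>C e n) \<and>
    sparse_constraints (4 * card I) d V \<and>
    (\<forall>i\<in>I. dominated_off V d (Z i) \<and> dominated_off V d (adj (Z i)))"
  using I Z
proof (induction I)
  case empty
  show ?case
    by (rule exI[of _ 0], rule exI[of _ "\<lambda>_. 0"], rule exI[of _ "\<lambda>_. {}"])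
      (simp add: ideal_zero[OF S] sparse_constraints_def)
next
  case (insert j I)
  have "Z i \<in> S" if "i \<in> I" for i using insert.prems that by simp
  from insert.IH[OF this] obtain D d V where DV: "D \<in> S \<and> (\<forall>n. D (e n) = complex_of_real (d n) *\<^sub>C e n) \<and>
    sparse_constraints (4 * card I) d V \<and>
    (\<forall>i\<in>I. dominated_off V d (Z i) \<and> dominated_off V d (adj (Z i)))"
    by blast
  then have D: "D \<in> S" "\<And>n. D (e n) = complex_of_real (d n) *\<^sub>C e n"
    and V: "sparse_constraints (4 * card I) d V"
      "\<And>i. i \<in> I \<Longrightarrow> dominated_off V d (Z i) \<and> dominated_off V d (adj (Z i))"
    by simp_all
  have Zj: "Z j \<in> S" using insert.prems by simp
  obtain D' d' V' where D': "D' \<in> S" "\<forall>n. D' (e n) = complex_of_real (d' n) *\<^sub>C e n"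
    and V': "sparse_constraints 4 d' V'" "dominated_off V' d' (Z j)" "dominated_off V' d' (adj (Z j))"
    using ideal_diagonal[OF e S Zj] by blast
  let ?V = "\<lambda>n. V n \<union> V' n" and ?d = "\<lambda>n. d n + d' n"
  have dom: "dominated_off V d X \<Longrightarrow> dominated_off ?V ?d X"
    "dominated_off V' d' X \<Longrightarrow> dominated_off ?V ?d X" for X
    using V(1) V'(1) by (auto simp: sparse_constraints_def elim!: dominated_off_mono)
  show ?case
  proof (intro exI conjI allI ballI)
    show "D + D' \<in> S" by (intro ideal_add[OF S] D D')
    show "(D + D') (e n) = complex_of_real (?d n) *\<^sub>C e n" for n
      by (simp add: blinfun.add_left D D' scaleC_add_left)
    show "sparse_constraints (4 * card (insert j I)) ?d ?V"
      using sparse_constraints_join[OF V(1) V'(1)] insert.hyps by (simp add: algebra_simps)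
    fix i assume "i \<in> insert j I"
    then show "dominated_off ?V ?d (Z i)" "dominated_off ?V ?d (adj (Z i))"
      using V(2) V'(2,3) dom by auto
  qed
qed

section \<open>Compressed traces\<close>

definition compressed_trace :: "(nat \<Rightarrow> 'h::chilbert_space) \<Rightarrow> nat \<Rightarrow> ('h \<Rightarrow>\<^sub>L 'h) \<Rightarrow> complex" where
  "compressed_trace g m X = (\<Sum>j<m. cinner (X (g j)) (g j))"

text \<open>
  Write \<open>p\<close> for the projection onto the span of \<open>g\<close>. The matrices of \<open>p Z p\<close> and \<open>p B p\<close>
  have a commutator of trace 0, so only \<open>p Z (1 - p) B p\<close> and \<open>p B (1 - p) Z p\<close> contribute.
  Each of the \<open>m\<close> diagonal entries of either is at most \<open>\<eta> \<parallel>B\<parallel>\<close>; for the second one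
  this uses the bound on the adjoint of \<open>Z\<close>.
\<close>

lemma compressed_trace_commutator:
  assumes g: "orthonormal_family g m" and Z: "Z \<in> BH" and B: "B \<in> BH"
    and small: "\<And>y. (\<And>j. j < m \<Longrightarrow> cinner y (g j) = 0) \<Longrightarrow>
      norm (Z y) \<le> \<eta> * norm y \<and> norm (adj Z y) \<le> \<eta> * norm y"
    and \<eta>: "0 \<le> \<eta>"
  shows "cmod (compressed_trace g m (Z o\<^sub>L B) - compressed_trace g m (B o\<^sub>L Z)) \<le> 2 * real m * \<eta> * norm B"
proof -
  let ?p = "proj g m"
  define a where "a j = cinner (Z (B (g j) - ?p (B (g j)))) (g j)" for j
  define b where "b j = cinner (g j) (adj Z (adj B (g j) - ?p (adj B (g j))))" for j
  have nB: "norm (B (g j)) \<le> norm B" "norm (adj B (g j)) \<le> norm B" if "j < m" for j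
    using norm_blinfun[of B "g j"] norm_blinfun[of "adj B" "g j"] norm_adj_le[OF B]
      orthonormal_family_norm[OF g that] by auto
  have sm: "norm (Z (y - ?p y)) \<le> \<eta> * norm B" "norm (adj Z (y - ?p y)) \<le> \<eta> * norm B"
    if "norm y \<le> norm B" for y
  proof -
    have "\<eta> * norm (y - ?p y) \<le> \<eta> * norm B"
      using norm_diff_proj_le[OF g, of y] that \<eta> by (intro mult_left_mono) auto
    then show "norm (Z (y - ?p y)) \<le> \<eta> * norm B" "norm (adj Z (y - ?p y)) \<le> \<eta> * norm B"
      using small[of "y - ?p y"] cinner_diff_proj_basis[OF g] by fastforce+
  qed
  have ab: "cmod (a j) \<le> \<eta> * norm B" "cmod (b j) \<le> \<eta> * norm B" if "j < m" for j
    using cinner_Cauchy_Schwarz[of "Z (B (g j) - ?p (B (g j)))" "g j"]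
      cinner_Cauchy_Schwarz[of "g j" "adj Z (adj B (g j) - ?p (adj B (g j)))"]
      sm[OF nB(1)[OF that]] sm[OF nB(2)[OF that]] orthonormal_family_norm[OF g that]
    by (auto simp: a_def b_def)
  have 1: "cinner (Z (B (g j))) (g j) = (\<Sum>k<m. cinner (B (g j)) (g k) * cinner (Z (g k)) (g j)) + a j" for j
  proof -
    have "Z (?p (B (g j))) = (\<Sum>k<m. cinner (B (g j)) (g k) *\<^sub>C Z (g k))"
      by (simp add: proj_def blinfun.sum_right BH_scaleC[OF Z])
    then show ?thesis by (simp add: a_def blinfun.diff_right cinner_simps)
  qed
  have 2: "cinner (B (Z (g j))) (g j) = (\<Sum>k<m. cinner (Z (g j)) (g k) * cinner (B (g k)) (g j)) + b j" for j
  proof -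
    have "cinner (B (Z (g j))) (g j) = cinner (Z (g j)) (adj B (g j))" by (simp add: cinner_adj B)
    also have "\<dots> = cinner (Z (g j)) (?p (adj B (g j))) + b j"
      unfolding b_def cinner_adj[OF Z, symmetric] by (simp add: cinner_diff_right)
    finally show ?thesis by (simp add: cinner_proj_right cinner_adj[OF B])
  qed
  have "compressed_trace g m (Z o\<^sub>L B) - compressed_trace g m (B o\<^sub>L Z) = (\<Sum>j<m. a j - b j)"
  proof -
    have "(\<Sum>j<m. \<Sum>k<m. cinner (B (g j)) (g k) * cinner (Z (g k)) (g j)) =
        (\<Sum>j<m. \<Sum>k<m. cinner (Z (g j)) (g k) * cinner (B (g k)) (g j))"
      by (subst sum.swap) (simp add: mult.commute)
    then show ?thesis
      by (simp add: compressed_trace_def 1 2 sum.distrib sum_subtractf)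
  qed
  also have "cmod \<dots> \<le> (\<Sum>j<m. cmod (a j - b j))" by (rule norm_sum)
  also have "\<dots> \<le> (\<Sum>j<m. \<eta> * norm B + \<eta> * norm B)"
    using ab by (intro sum_mono norm_triangle_le_diff add_mono) auto
  finally show ?thesis by simp
qed

section \<open>Compact operators\<close>

definition compact_op :: "('h::chilbert_space \<Rightarrow>\<^sub>L 'h) \<Rightarrow> bool" where
  "compact_op L \<longleftrightarrow> (\<forall>y :: nat \<Rightarrow> 'h. (\<forall>k. norm (y k) \<le> 1) \<longrightarrow>
     (\<exists>z r. strict_mono r \<and> (\<lambda>k. L (y (r k))) \<longlonglongrightarrow> z))"

lemma compact_coefficient_box:
  fixes g :: "nat \<Rightarrow> 'h::chilbert_space"
  shows "compact {\<Sum>j<m. c j *\<^sub>C g j | c. \<forall>j. cmod (c j) \<le> 1}"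
proof (induction m)
  case 0
  have "{(\<Sum>j<0. c j *\<^sub>C g j) | c :: nat \<Rightarrow> complex. \<forall>j. cmod (c j) \<le> 1} = {0}"
    by (auto intro!: exI[of _ "\<lambda>_. 0"])
  then show ?case by simp
next
  case (Suc m)
  let ?B = "\<lambda>m. {\<Sum>j<m. c j *\<^sub>C g j | c. \<forall>j. cmod (c j) \<le> 1}"
  have "continuous_on (cball 0 1) (\<lambda>c. c *\<^sub>C g m)"
    by (intro linear_continuous_on bounded_linear_intro[where K = "norm (g m)"])
      (simp_all add: scaleC_add_left norm_scaleC scaleC_scaleC scaleR_conv_of_real
        flip: scaleC_of_real)
  then have "compact ((\<lambda>c. c *\<^sub>C g m) ` cball 0 1)"
    by (rule compact_continuous_image) simp
  from compact_sums[OF Suc this]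
  have "compact {x + y |x y. x \<in> ?B m \<and> y \<in> (\<lambda>c. c *\<^sub>C g m) ` cball 0 1}" .
  also have "{x + y |x y. x \<in> ?B m \<and> y \<in> (\<lambda>c. c *\<^sub>C g m) ` cball 0 1} = ?B (Suc m)"
  proof (intro equalityI subsetI)
    fix z assume "z \<in> {x + y |x y. x \<in> ?B m \<and> y \<in> (\<lambda>c. c *\<^sub>C g m) ` cball 0 1}"
    then obtain c a where c: "z = (\<Sum>j<m. c j *\<^sub>C g j) + a *\<^sub>C g m" "\<forall>j. cmod (c j) \<le> 1" "cmod a \<le> 1"
      by auto
    have "z = (\<Sum>j<Suc m. (c(m := a)) j *\<^sub>C g j)" by (simp add: c(1))
    moreover have "\<forall>j. cmod ((c(m := a)) j) \<le> 1" using c by simp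
    ultimately show "z \<in> ?B (Suc m)" by blast
  next
    fix z assume "z \<in> ?B (Suc m)"
    then obtain c where c: "z = (\<Sum>j<m. c j *\<^sub>C g j) + c m *\<^sub>C g m" "\<forall>j. cmod (c j) \<le> 1"
      by auto
    then have "(\<Sum>j<m. c j *\<^sub>C g j) \<in> ?B m" "c m *\<^sub>C g m \<in> (\<lambda>c. c *\<^sub>C g m) ` cball 0 1"
      by auto
    then show "z \<in> {x + y |x y. x \<in> ?B m \<and> y \<in> (\<lambda>c. c *\<^sub>C g m) ` cball 0 1}"
      using c(1) by blast
  qed
  finally show ?case .
qed

text \<open>
  The image of the unit ball is within \<open>2 d n\<close> of a compact subset of a finite-dimensional space,
  so it is totally bounded.
\<close>

lemma compact_of_dominated:
  assumes V: "sparse_constraints K d V" "dominated_off V d L" and d: "d \<longlonglongrightarrow> 0"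
  shows "compact_op L"
proof -
  let ?T = "L ` cball 0 1"
  have "\<exists>F. finite F \<and> F \<subseteq> ?T \<and> ?T \<subseteq> (\<Union>z\<in>F. ball z \<epsilon>)" if \<epsilon>: "\<epsilon> > 0" for \<epsilon>
  proof -
    obtain n where n: "d n < \<epsilon> / 4"
      using order_tendstoD(2)[OF d, of "\<epsilon> / 4"] \<epsilon> by (auto simp: eventually_sequentially)
    have "finite (V n)" using V(1) by (simp add: sparse_constraints_def)
    then obtain g m where g: "orthonormal_family g m" "\<And>v. v \<in> V n \<Longrightarrow> proj g m v = v"
      using Gram_Schmidt[of "V n"] by metis
    define G where "G = {\<Sum>j<m. c j *\<^sub>C g j | c. \<forall>j. cmod (c j) \<le> 1} \<inter> cball 0 1"
    have "compact (L ` G)"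
      unfolding G_def
      by (intro compact_continuous_image compact_Int_closed compact_coefficient_box closed_cball
          linear_continuous_on blinfun.bounded_linear_right)
    from seq_compact_imp_totally_bounded[OF this[unfolded compact_eq_seq_compact_metric]] \<epsilon>
    obtain F where F: "finite F" "F \<subseteq> L ` G" "L ` G \<subseteq> (\<Union>z\<in>F. ball z (\<epsilon> / 2))"
      by (metis half_gt_zero)
    have "?T \<subseteq> (\<Union>z\<in>F. ball z \<epsilon>)"
    proof
      fix x assume "x \<in> ?T"
      then obtain y where y: "x = L y" "norm y \<le> 1" by auto
      have c1: "cmod (cinner y (g j)) \<le> 1" if "j < m" for j
        using cinner_Cauchy_Schwarz[of y "g j"] y(2) orthonormal_family_norm[OF g(1) that] by simp
      have "proj g m y = (\<Sum>j<m. (if j < m then cinner y (g j) else 0) *\<^sub>C g j)"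
        unfolding proj_def by (intro sum.cong) auto
      moreover have "\<forall>j. cmod (if j < m then cinner y (g j) else 0) \<le> 1" using c1 by simp
      ultimately have "proj g m y \<in> {\<Sum>j<m. c j *\<^sub>C g j | c. \<forall>j. cmod (c j) \<le> 1}"
        unfolding mem_Collect_eq by (intro exI[of _ "\<lambda>j. if j < m then cinner y (g j) else 0"] conjI)
      then have "L (proj g m y) \<in> L ` G"
        using norm_proj_le[OF g(1), of y] y(2) by (simp add: G_def)
      then obtain z where z: "z \<in> F" "dist z (L (proj g m y)) < \<epsilon> / 2" using F(3) by auto
      have "norm (L (y - proj g m y)) \<le> 2 * d n * norm (y - proj g m y)"
        using V(2) diff_proj_orthogonal[OF g(1) g(2)] by (simp add: dominated_off_def)
      also have "\<dots> \<le> 2 * d n * 1"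
        using norm_diff_proj_le[OF g(1), of y] y(2) V(1)
        by (intro mult_left_mono) (auto simp: sparse_constraints_def)
      finally have "dist (L (proj g m y)) x < \<epsilon> / 2"
        using n by (simp add: y(1) dist_norm blinfun.diff_right norm_minus_commute)
      then have "x \<in> ball z \<epsilon>" using z(2) dist_triangle_half_r[of "L (proj g m y)" z \<epsilon> x]
        by (simp add: dist_commute)
      then show "x \<in> (\<Union>z\<in>F. ball z \<epsilon>)" using z(1) by blast
    qed
    then show ?thesis using F by (intro exI[of _ F]) (auto simp: G_def)
  qed
  then have "Met_TC.mtotally_bounded ?T" by (simp add: Met_TC.mtotally_bounded_def)
  then have ex: "\<exists>r. strict_mono r \<and> Cauchy (\<sigma> \<circ> r)" if "range \<sigma> \<subseteq> ?T" for \<sigma> :: "nat \<Rightarrow> 'a"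
    using that by (simp add: Met_TC.mtotally_bounded_sequentially)
  show ?thesis
    unfolding compact_op_def
  proof (intro allI impI)
    fix y :: "nat \<Rightarrow> 'a" assume y: "\<forall>k. norm (y k) \<le> 1"
    have "range (\<lambda>k. L (y k)) \<subseteq> ?T" by (intro image_subsetI imageI) (simp add: y)
    then obtain r where r: "strict_mono r" "Cauchy ((\<lambda>k. L (y k)) \<circ> r)"
      using ex[of "\<lambda>k. L (y k)"] by auto
    then obtain z where "((\<lambda>k. L (y k)) \<circ> r) \<longlonglongrightarrow> z"
      using Cauchy_convergent convergent_def by blast
    then show "\<exists>z r. strict_mono r \<and> (\<lambda>k. L (y (r k))) \<longlonglongrightarrow> z"
      using r(1) by (auto simp: o_def)
  qed
qed

text \<open>
  If the diagonal \<open>d\<close> extracted from \<open>L\<close> does not tend to 0, then, being almost decreasing, it is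
  bounded below by a positive constant and dominates the harmonic sequence.
\<close>

lemma compact_if_omega_notin:
  fixes L :: "'h::separable_infinite_dim_chilbert_space \<Rightarrow>\<^sub>L 'h"
  assumes e: "orthonormal_basis e" and S: "two_sided_ideal S" and L: "L \<in> S"
    and omega: "diag_op e omega \<notin> S"
  shows "compact_op L"
proof -
  obtain D d V where D: "D \<in> S" "\<forall>n. D (e n) = complex_of_real (d n) *\<^sub>C e n"
    and V: "sparse_constraints 4 d V" "dominated_off V d L" "dominated_off V d (adj L)"
    using ideal_diagonal[OF e S L] by blast
  have d: "0 \<le> d n" "n \<le> m \<Longrightarrow> d m \<le> 2 * d n" for m n
    using V(1) by (auto simp: sparse_constraints_def)
  have "d \<longlonglongrightarrow> 0"
  proof (rule ccontr)
    assume "\<not> d \<longlonglongrightarrow> 0"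
    then obtain \<epsilon> where \<epsilon>: "\<epsilon> > 0" "\<And>N. \<exists>n\<ge>N. \<epsilon> \<le> d n"
      using d(1) by (auto simp: LIMSEQ_iff not_less)
    have "diag_op e omega \<in> S"
    proof (rule omega_in_ideal[OF e S D(1)])
      fix n :: nat assume n: "n \<ge> 1"
      obtain m where "m \<ge> n" "\<epsilon> \<le> d m" using \<epsilon>(2) by blast
      then have "\<epsilon> / 2 \<le> d n" using d(2)[of n m] by linarith
      also have "d n = 1 * d n" by simp
      also have "\<dots> \<le> real n * d n" using n d(1)[of n] by (intro mult_right_mono) auto
      finally show "\<epsilon> / 2 \<le> real n * d n" .
    qed (use D(2) d \<epsilon>(1) in auto)
    then show False using omega by simp
  qed
  then show ?thesis by (rule compact_of_dominated[OF V(1,2)])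
qed

text \<open>
  Each \<open>f n\<close> maximises \<open>\<parallel>L y\<parallel>\<close> among the unit vectors orthogonal to the earlier ones, and the
  first-order condition makes it an eigenvector of \<open>L\<^sup>* L\<close>. The images \<open>L (f n)\<close> are orthogonal
  and have a convergent subsequence, so their norms become small; by maximality \<open>L\<close> vanishes on the
  vectors orthogonal to all \<open>f n\<close>.
\<close>

lemma compact_spectral:
  fixes L :: "'h::separable_infinite_dim_chilbert_space \<Rightarrow>\<^sub>L 'h"
  assumes L: "L \<in> BH" "compact_op L"
  obtains f where "orthonormal_seq f"
    "\<forall>n. adj L (L (f n)) = complex_of_real ((norm (L (f n)))\<^sup>2) *\<^sub>C f n"
    "\<forall>y. (\<forall>n. cinner y (f n) = 0) \<longrightarrow> L y = 0"
proof -
  define orth where "orth V = {y::'h. \<forall>v\<in>V. cinner y v = 0}" for V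
  have sub: "subspace (orth V)" for V
    by (auto simp: subspace_def orth_def cinner_add_left cinner_scaleR_left)
  have cl: "closed (orth V)" for V
  proof -
    have "orth V = (\<Inter>v\<in>V. {y. cinner y v = 0})" by (auto simp: orth_def)
    moreover have "closed {y. cinner y v = 0}" for v :: 'h
      by (intro closed_Collect_eq continuous_on_const linear_continuous_on bounded_linear_cinner_left)
    ultimately show ?thesis by auto
  qed
  have "\<exists>x. x \<in> orth V \<and> norm x = 1 \<and> (\<forall>y\<in>orth V. norm (L y) \<le> norm (L x) * norm y)"
    if V: "finite V" for V
  proof -
    obtain u where "norm u = 1" "\<And>v. v \<in> V \<Longrightarrow> cinner u v = 0"
      using ex_unit_vector_orthogonal[OF V] by blast
    then have u: "u \<in> orth V" "u \<noteq> 0" by (auto simp: orth_def)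
    have "\<exists>z r. strict_mono r \<and> (\<lambda>k. L (y (r k))) \<longlonglongrightarrow> z"
      if "\<And>k::nat. y k \<in> orth V \<and> norm (y k) = 1" for y
      using L(2) that unfolding compact_op_def by simp
    from compact_maps_attain_norm[OF blinfun.bounded_linear_right sub cl u this]
    obtain x where "x \<in> orth V" "norm x = 1" "\<And>y. y \<in> orth V \<Longrightarrow> norm (L y) \<le> norm (L x) * norm y"
      by metis
    then show ?thesis by blast
  qed
  note greedy = greedy_sequence[of "\<lambda>V x. x \<in> orth V \<and> norm x = 1 \<and>
      (\<forall>y\<in>orth V. norm (L y) \<le> norm (L x) * norm y)" "\<lambda>y. y", OF this]
  obtain f where "\<forall>n. f n \<in> orth (avoided (\<lambda>y. y) f n) \<and> norm (f n) = 1 \<and>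
      (\<forall>y\<in>orth (avoided (\<lambda>y. y) f n). norm (L y) \<le> norm (L (f n)) * norm y)"
    by (rule greedy) blast+
  then have f: "\<And>n. f n \<in> orth (avoided (\<lambda>y. y) f n)" "\<And>n. norm (f n) = 1"
    and le: "\<And>n y. y \<in> orth (avoided (\<lambda>y. y) f n) \<Longrightarrow> norm (L y) \<le> norm (L (f n)) * norm y"
    by auto
  have av: "avoided (\<lambda>y. y) f n = f ` {..<n}" for n by (auto simp: avoided_def)
  have on: "orthonormal_seq f"
    by (rule greedy_orthonormal[of f "\<lambda>y. y"]) (use f in \<open>auto simp: orth_def\<close>)
  have eig: "adj L (L (f n)) = complex_of_real ((norm (L (f n)))\<^sup>2) *\<^sub>C f n" for n
  proof (induction n rule: less_induct)
    case (less n)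
    define s where "s = (norm (L (f n)))\<^sup>2"
    define w where "w = complex_of_real s *\<^sub>C f n - adj L (L (f n))"
    have "cinner w (f j) = 0" if "j < n" for j
    proof -
      have "cinner (f n) (f j) = 0" using on that by (simp add: orthonormal_seq_def)
      then show ?thesis
        using less[OF that] L(1)
        by (simp add: w_def cinner_simps cinner_adj_left cinner_adj)
    qed
    then have w: "w \<in> orth (avoided (\<lambda>y. y) f n)" by (auto simp: av orth_def)
    have "inner (L (f n)) (L w) = s * inner (f n) w"
      unfolding s_def
      by (rule norm_attaining_first_order[OF blinfun.bounded_linear_right sub f(1) w f(2)]) (rule le)
    also have "inner (L (f n)) (L w) = inner (adj L (L (f n))) w"
      by (simp add: inner_eq_Re_cinner cinner_adj_left L(1))
    finally have "inner (s *\<^sub>R f n - adj L (L (f n))) w = 0"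
      by (simp add: inner_diff_left)
    then have "inner w w = 0" by (simp add: w_def scaleC_of_real)
    then show ?case by (simp add: w_def s_def)
  qed
  have "L y = 0" if y: "\<And>n. cinner y (f n) = 0" for y
  proof (rule ccontr)
    assume nz: "L y \<noteq> 0"
    then have y0: "norm y > 0" by auto
    define c where "c = norm (L y) / norm y"
    have c: "c > 0" using nz y0 by (simp add: c_def)
    have ge: "c \<le> norm (L (f n))" for n
      using le[of y n] y y0 by (simp add: c_def orth_def av field_simps)
    obtain z r where r: "strict_mono (r::nat\<Rightarrow>nat)" "(\<lambda>k. L (f (r k))) \<longlonglongrightarrow> z"
      using L(2) f(2) unfolding compact_op_def by (metis order_refl)
    then have "Cauchy (\<lambda>k. L (f (r k)))" by (simp add: LIMSEQ_imp_Cauchy)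
    then obtain N where N: "\<And>m n. m \<ge> N \<Longrightarrow> n \<ge> N \<Longrightarrow> norm (L (f (r m)) - L (f (r n))) < c"
      using c unfolding Cauchy_iff by blast
    let ?a = "L (f (r N))" and ?b = "L (f (r (Suc N)))"
    have "r N \<noteq> r (Suc N)" using r(1) by (simp add: strict_mono_eq)
    then have "cinner ?a (- ?b) = 0"
      using on eig[of "r (Suc N)"] L(1)
      by (simp add: cinner_minus_right cinner_adj cinner_scaleC_right orthonormal_seq_def)
    from norm_square_add_orthogonal[OF this]
    have "(norm (?a - ?b))\<^sup>2 = (norm ?a)\<^sup>2 + (norm ?b)\<^sup>2" by simp
    moreover have "c\<^sup>2 \<le> (norm ?a)\<^sup>2" using ge c by (intro power_mono) auto
    moreover have "(norm (?a - ?b))\<^sup>2 < c\<^sup>2" using N[of N "Suc N"] by (intro power_strict_mono) auto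
    ultimately show False using zero_le_power2[of "norm ?b"] by linarith
  qed
  then show ?thesis using on eig by (intro that[of f]) auto
qed

section \<open>Absolute values and trace class operators\<close>

text \<open>
  This yields the uniqueness of the positive square root: it is determined on every eigenvector of
  its square. For \<open>s > 0\<close> the vector \<open>v = P x - s x\<close> satisfies \<open>P v = - s v\<close>, which positivity
  forbids unless \<open>v = 0\<close>.
\<close>

lemma positive_op_eigenvector:
  assumes P: "positive_op P" and eq: "P (P x) = complex_of_real (s\<^sup>2) *\<^sub>C x" and s: "0 \<le> s"
  shows "P x = complex_of_real s *\<^sub>C x"
proof (cases "s = 0")
  case True
  define v where "v = P x"
  have Pv: "P v = 0" using eq True by (simp add: v_def)
  \<comment> \<open>\<open>Re \<langle>P (x + tv), x + tv\<rangle>\<close> is affine in \<open>t\<close> with slope \<open>\<parallel>v\<parallel>\<^sup>2\<close>, hence nonnegative only if \<open>v = 0\<close>.\<close>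
  have "0 \<le> Re (cinner v x) + t * (norm v)\<^sup>2" for t
  proof -
    have "0 \<le> Re (cinner (P (x + t *\<^sub>R v)) (x + t *\<^sub>R v))"
      using P by (simp add: positive_op_def)
    then show ?thesis
      by (simp add: blinfun.add_right blinfun.scaleR_right Pv v_def[symmetric] cinner_add_right
          cinner_scaleR_right cinner_self)
  qed
  from this[of "- (Re (cinner v x) + 1) / (norm v)\<^sup>2"] have "v = 0"
    by (cases "v = 0") (simp_all add: field_simps)
  then show ?thesis using True by (simp add: v_def)
next
  case False
  define v where "v = P x - complex_of_real s *\<^sub>C x"
  have BH: "P \<in> BH" using P by (simp add: positive_op_def)
  have "P v = complex_of_real (- s) *\<^sub>C v"
    by (simp only: v_def blinfun.diff_right eq BH_scaleC[OF BH] scaleC_of_real power2_eq_square)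
      (simp add: blinfun.scaleR_right scaleR_diff_right)
  then have "Re (cinner (P v) v) = - s * (norm v)\<^sup>2"
    by (simp add: cinner_scaleC_left cinner_self)
  moreover have "0 \<le> Re (cinner (P v) v)" using P by (simp add: positive_op_def)
  ultimately have "s * (norm v)\<^sup>2 \<le> 0" by simp
  moreover have "0 < s" using s False by simp
  ultimately have "(norm v)\<^sup>2 \<le> 0" by (simp add: mult_le_0_iff)
  then show ?thesis by (simp add: v_def)
qed

lemma abs_op_zero: "abs_op 0 = (0 :: 'h::chilbert_space \<Rightarrow>\<^sub>L 'h)"
  unfolding abs_op_def
proof (rule the_equality)
  have "adj (0 :: 'h \<Rightarrow>\<^sub>L 'h) = 0" by (rule adj_eqI) auto
  then show "positive_op (0 :: 'h \<Rightarrow>\<^sub>L 'h) \<and> 0 o\<^sub>L 0 = adj 0 o\<^sub>L (0 :: 'h \<Rightarrow>\<^sub>L 'h)"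
    by (simp add: positive_op_def)
next
  fix P :: "'h \<Rightarrow>\<^sub>L 'h" assume P: "positive_op P \<and> P o\<^sub>L P = adj 0 o\<^sub>L 0"
  have "P (P x) = 0" for x
    using P blinfun_apply_blinfun_compose[of P P x] by simp
  then have "P x = 0" for x using positive_op_eigenvector[of P x 0] P by simp
  then show "P = 0" by (intro blinfun_eqI) simp
qed

lemma trace_class_zero:
  assumes "orthonormal_basis (e :: nat \<Rightarrow> 'h::chilbert_space)"
  shows "trace_class (0 :: 'h \<Rightarrow>\<^sub>L 'h)"
  using assms by (auto simp: trace_class_def abs_op_zero)

lemma operator_expansion:
  fixes X :: "'h::chilbert_space \<Rightarrow>\<^sub>L 'h"
  assumes X: "X \<in> BH" and f: "orthonormal_seq f" and vanish: "\<And>y. (\<And>n. cinner y (f n) = 0) \<Longrightarrow> X y = 0"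
  shows "(\<lambda>k. cinner x (f k) *\<^sub>C X (f k)) sums X x"
proof -
  have "(\<lambda>k. cinner x (f k) *\<^sub>C f k) sums synthesis f f x"
    by (rule synthesis_sums[OF f orthonormal_seq_orthogonal[OF f], where C = 1])
      (simp add: orthonormal_seq_norm[OF f])
  from bounded_linear.sums[OF blinfun.bounded_linear_right this, of X]
  have "(\<lambda>k. cinner x (f k) *\<^sub>C X (f k)) sums X (synthesis f f x)"
    by (simp add: BH_scaleC[OF X])
  moreover have "X (x - synthesis f f x) = 0"
    by (rule vanish) (rule orthogonal_residual[OF f])
  ultimately show ?thesis by (simp add: blinfun.diff_right)
qed

text \<open>
  The operator with eigenvalue \<open>\<parallel>L (f k)\<parallel>\<close> at \<open>f k\<close> that vanishes on the orthogonal
  complement is a positive square root of \<open>L\<^sup>* L\<close>, and the only one, so \<open>abs_op L\<close> is this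
  operator.
\<close>

lemma abs_op_compact:
  fixes L :: "'h::chilbert_space \<Rightarrow>\<^sub>L 'h"
  assumes L: "L \<in> BH" and f: "orthonormal_seq f"
    and eig: "\<And>n. adj L (L (f n)) = complex_of_real ((norm (L (f n)))\<^sup>2) *\<^sub>C f n"
    and vanish: "\<And>y. (\<And>n. cinner y (f n) = 0) \<Longrightarrow> L y = 0"
  shows "(\<lambda>k. norm (L (f k)) * (cmod (cinner x (f k)))\<^sup>2) sums Re (cinner (abs_op L x) x)"
proof -
  define s where "s k = norm (L (f k))" for k
  define y where "y k = complex_of_real (s k) *\<^sub>C f k" for k
  have y: "orthogonal_seq y"
    using orthonormal_seq_orthogonal[OF f] by (simp add: orthogonal_seq_def y_def cinner_simps)
  have yC: "norm (y k) \<le> norm L" for k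
    using norm_blinfun[of L "f k"] orthonormal_seq_norm[OF f, of k] by (simp add: y_def s_def norm_scaleC)
  define P where "P = synthesis f y"
  have P: "P \<in> BH" "\<And>k. P (f k) = y k" "\<And>x. (\<lambda>k. cinner x (f k) *\<^sub>C y k) sums P x"
    using synthesis_BH[OF f y yC] synthesis_basis[OF f y yC] synthesis_sums[OF f y yC]
    by (auto simp: P_def)
  have P0: "P z = 0" if "\<And>n. cinner z (f n) = 0" for z
  proof -
    have "(\<lambda>k. 0) sums P z" using P(3)[of z] that by simp
    then show ?thesis using sums_zero sums_unique2 by blast
  qed
  have form: "(\<lambda>k. complex_of_real (s k * (cmod (cinner x (f k)))\<^sup>2)) sums cinner (P x) x" for x
  proof -
    have "cinner (cinner x (f k) *\<^sub>C y k) x = complex_of_real (s k * (cmod (cinner x (f k)))\<^sup>2)" for k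
      by (simp only: y_def cinner_scaleC_left complex_norm_square of_real_mult cinner_commute[of "f k" x])
         (simp add: mult_ac)
    then show ?thesis using cinner_suminf(1)[OF P(3)[of x], of x] by simp
  qed
  have re: "(\<lambda>k. s k * (cmod (cinner x (f k)))\<^sup>2) sums Re (cinner (P x) x)" for x
    using bounded_linear.sums[OF bounded_linear_Re form[of x]] by simp
  have pos: "positive_op P"
    unfolding positive_op_def
  proof (intro conjI allI)
    show "Im (cinner (P x) x) = 0" for x
    proof -
      have "(\<lambda>k. 0) sums Im (cinner (P x) x)"
        using bounded_linear.sums[OF bounded_linear_Im form[of x]] by simp
      then show ?thesis using sums_zero sums_unique2 by blast
    qed
    show "0 \<le> Re (cinner (P x) x)" for x
      using sums_le[OF _ sums_zero re[of x]] by (simp add: s_def)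
  qed (rule P(1))
  have "abs_op L = P"
    unfolding abs_op_def
  proof (rule the_equality)
    have "P (P x) = adj L (L x)" for x
    proof (rule sums_unique2)
      have "P (P z) = 0" if "\<And>n. cinner z (f n) = 0" for z using P0[OF that] by simp
      then show "(\<lambda>k. cinner x (f k) *\<^sub>C (P o\<^sub>L P) (f k)) sums P (P x)"
        using operator_expansion[of "P o\<^sub>L P" f x] P(1) f by simp
      have "adj L (L z) = 0" if "\<And>n. cinner z (f n) = 0" for z using vanish[OF that] by simp
      then have "(\<lambda>k. cinner x (f k) *\<^sub>C (adj L o\<^sub>L L) (f k)) sums adj L (L x)"
        using operator_expansion[of "adj L o\<^sub>L L" f x] L f by simp
      moreover have "(P o\<^sub>L P) (f k) = (adj L o\<^sub>L L) (f k)" for k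
        by (simp add: P(2) y_def BH_scaleC[OF P(1)] eig s_def scaleC_scaleC power2_eq_square)
      ultimately show "(\<lambda>k. cinner x (f k) *\<^sub>C (P o\<^sub>L P) (f k)) sums adj L (L x)" by simp
    qed
    then show "positive_op P \<and> P o\<^sub>L P = adj L o\<^sub>L L" using pos by (auto intro!: blinfun_eqI)
  next
    fix P' assume P': "positive_op P' \<and> P' o\<^sub>L P' = adj L o\<^sub>L L"
    then have sq: "P' (P' x) = adj L (L x)" for x
      using blinfun_apply_blinfun_compose[of P' P' x] by simp
    have P'f: "P' (f k) = y k" for k
      unfolding y_def using P' sq[of "f k"] by (intro positive_op_eigenvector) (auto simp: eig s_def)
    have P'0: "P' z = 0" if "\<And>n. cinner z (f n) = 0" for z
      using positive_op_eigenvector[of P' z 0] P' sq[of z] vanish[OF that] by simp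
    have P'BH: "P' \<in> BH" using P' by (simp add: positive_op_def)
    have "(\<lambda>k. cinner x (f k) *\<^sub>C y k) sums P' x" for x
      using operator_expansion[OF P'BH f P'0, of x] by (simp add: P'f)
    then have "P' x = P x" for x using P(3) sums_unique2 by blast
    then show "P' = P" by (rule blinfun_eqI)
  qed
  then show ?thesis using re[of x] by (simp add: s_def)
qed

lemma double_sums_swap:
  fixes a :: "nat \<Rightarrow> nat \<Rightarrow> real"
  assumes nonneg: "\<And>j k. 0 \<le> a j k" and r: "\<And>j. (\<lambda>k. a j k) sums r j" and c: "\<And>k. (\<lambda>j. a j k) sums c k"
    and sr: "summable r"
  shows "summable c" "suminf c \<le> suminf r"
proof -
  have le: "sum c {..<K} \<le> suminf r" for K
  proof (rule sums_le[OF _ _ summable_sums[OF sr]])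
    show "(\<lambda>j. \<Sum>k<K. a j k) sums sum c {..<K}" by (intro sums_sum c)
    show "(\<Sum>k<K. a j k) \<le> r j" for j
      using r[of j] nonneg by (metis sum_le_suminf sums_iff finite_lessThan)
  qed
  have c0: "0 \<le> c k" for k using sums_le[OF _ sums_zero c] nonneg by blast
  show "summable c" by (rule summableI_nonneg_bounded[OF c0 le])
  then show "suminf c \<le> suminf r" using le by (rule suminf_le_const)
qed

text \<open>
  The numbers \<open>\<parallel>L (f k)\<parallel>\<close> are the eigenvalues of the absolute value of \<open>L\<close>. Their sum is its
  trace, computed in the eigenbasis instead of the basis from the definition.
\<close>

lemma trace_class_expansion:
  fixes L :: "'h::separable_infinite_dim_chilbert_space \<Rightarrow>\<^sub>L 'h"
  assumes tc: "trace_class L" and L: "compact_op L"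
  obtains f where "orthonormal_seq f" "summable (\<lambda>k. norm (L (f k)))"
    "\<forall>x. (\<lambda>k. cinner x (f k) *\<^sub>C L (f k)) sums L x"
proof -
  have BH: "L \<in> BH" using tc by (simp add: trace_class_def)
  obtain f where f: "orthonormal_seq f"
    and eig: "\<forall>n. adj L (L (f n)) = complex_of_real ((norm (L (f n)))\<^sup>2) *\<^sub>C f n"
    and vanish: "\<forall>y. (\<forall>n. cinner y (f n) = 0) \<longrightarrow> L y = 0"
    using compact_spectral[OF BH L] by blast
  obtain b where b: "orthonormal_basis b" "summable (\<lambda>k. cinner (abs_op L (b k)) (b k))"
    using tc by (auto simp: trace_class_def)
  have "summable (\<lambda>k. norm (L (f k)))"
  proof (rule double_sums_swap(1))
    show "(\<lambda>k. norm (L (f k)) * (cmod (cinner (b j) (f k)))\<^sup>2) sums Re (cinner (abs_op L (b j)) (b j))" for j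
      using eig vanish by (intro abs_op_compact[OF BH f]) auto
    have "(\<lambda>j. norm (L (f k)) * (cmod (cinner (f k) (b j)))\<^sup>2) sums (norm (L (f k)) * (norm (f k))\<^sup>2)" for k
      by (intro sums_mult Parseval[OF b(1)])
    moreover have "cmod (cinner (f k) (b j)) = cmod (cinner (b j) (f k))" for j k
      by (metis cinner_commute complex_mod_cnj)
    ultimately show "(\<lambda>j. norm (L (f k)) * (cmod (cinner (b j) (f k)))\<^sup>2) sums norm (L (f k))" for k
      by (simp add: orthonormal_seq_norm[OF f])
    show "summable (\<lambda>j. Re (cinner (abs_op L (b j)) (b j)))"
      by (rule bounded_linear.summable[OF bounded_linear_Re b(2)])
  qed simp
  then show ?thesis using that f operator_expansion[OF BH f] vanish by blast
qed

section \<open>Convergence of compressed traces\<close>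

text \<open>
  With \<open>p\<close> the projection onto the span of \<open>g\<close>, the compressed trace is
  \<open>\<Sum>\<^sub>k \<langle>h\<^sub>k, p f\<^sub>k\<rangle>\<close> while the trace is \<open>\<Sum>\<^sub>k \<langle>h\<^sub>k, f\<^sub>k\<rangle>\<close>. The error bound
  decreases when the span of \<open>g\<close> grows.
\<close>

lemma compressed_trace_nuclear:
  fixes X :: "'h::chilbert_space \<Rightarrow>\<^sub>L 'h"
  assumes g: "orthonormal_family g m" and f: "orthonormal_seq f"
    and h: "summable (\<lambda>k. norm (h k))"
    and X: "\<And>x. (\<lambda>k. cinner x (f k) *\<^sub>C h k) sums X x"
  shows "cmod (compressed_trace g m X - (\<Sum>k. cinner (h k) (f k)))
    \<le> (\<Sum>k. norm (h k) * norm (f k - proj g m (f k)))"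
proof -
  have "(\<lambda>k. cinner (h k) (proj g m (f k))) sums compressed_trace g m X"
  proof -
    have "(\<lambda>k. \<Sum>j<m. cinner (cinner (g j) (f k) *\<^sub>C h k) (g j)) sums compressed_trace g m X"
      unfolding compressed_trace_def by (intro sums_sum cinner_suminf(1) X)
    then show ?thesis by (simp add: cinner_proj_right cinner_scaleC_left mult.commute)
  qed
  moreover have "(\<lambda>k. cinner (h k) (f k)) sums (\<Sum>k. cinner (h k) (f k))"
  proof (rule summable_sums, rule summable_comparison_test[OF _ h], intro exI allI impI)
    show "norm (cinner (h k) (f k)) \<le> norm (h k)" for k
      using cinner_Cauchy_Schwarz[of "h k" "f k"] orthonormal_seq_norm[OF f, of k] by simp
  qed
  ultimately have s: "(\<lambda>k. cinner (h k) (proj g m (f k) - f k)) sums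
      (compressed_trace g m X - (\<Sum>k. cinner (h k) (f k)))"
    unfolding cinner_diff_right by (rule sums_diff)
  have le: "norm (cinner (h k) (proj g m (f k) - f k)) \<le> norm (h k) * norm (f k - proj g m (f k))" for k
    using cinner_Cauchy_Schwarz[of "h k" "proj g m (f k) - f k"] by (simp add: norm_minus_commute)
  have "summable (\<lambda>k. norm (h k) * norm (f k - proj g m (f k)))"
  proof (rule summable_comparison_test[OF _ h], intro exI allI impI)
    show "norm (norm (h k) * norm (f k - proj g m (f k))) \<le> norm (h k)" for k
      using norm_diff_proj_le[OF g, of "f k"] orthonormal_seq_norm[OF f, of k]
      by (simp add: mult_left_le)
  qed
  from norm_suminf_le[OF le this] show ?thesis using sums_unique[OF s] by simp
qed

lemma nuclear_tail_tendsto_0: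
  assumes e: "orthonormal_basis e" and f: "orthonormal_seq f" and h: "summable (\<lambda>k. norm (h k))"
  shows "(\<lambda>n. \<Sum>k. norm (h k) * norm (f k - proj e n (f k))) \<longlonglongrightarrow> 0"
proof -
  have "(\<lambda>n. norm (h k) * norm (f k - proj e n (f k))) \<longlonglongrightarrow> norm (h k) * norm (f k - f k)" for k
    using orthonormal_basis_expansion[OF e, of "f k"]
    by (intro tendsto_intros) (simp add: sums_def proj_def)
  then have lim: "(\<lambda>n. norm (h k) * norm (f k - proj e n (f k))) \<longlonglongrightarrow> 0" for k by simp
  have "norm (norm (h k) * norm (f k - proj e n (f k))) \<le> norm (h k)" for k n
    using norm_diff_proj_le[OF orthonormal_seq_family[OF orthonormal_basis_seq[OF e]], of "f k" n]
      orthonormal_seq_norm[OF f, of k] by (simp add: mult_left_le)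
  then have "\<forall>\<^sub>F (k, n) in sequentially \<times>\<^sub>F sequentially.
      norm (norm (h k) * norm (f k - proj e n (f k))) \<le> norm (h k)"
    by (intro always_eventually) auto
  from tannerys_theorem[OF lim this h] show ?thesis by simp
qed

lemma op_trace_nuclear:
  fixes X :: "'h::chilbert_space \<Rightarrow>\<^sub>L 'h" and e :: "nat \<Rightarrow> 'h"
  assumes e: "orthonormal_basis e" and f: "orthonormal_seq f" and h: "summable (\<lambda>k. norm (h k))"
    and X: "\<And>x. (\<lambda>k. cinner x (f k) *\<^sub>C h k) sums X x"
  shows "op_trace X = (\<Sum>k. cinner (h k) (f k))"
  unfolding op_trace_def
proof (rule the_equality)
  have sums: "(\<lambda>k. cinner (X (b k)) (b k)) sums (\<Sum>k. cinner (h k) (f k))"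
    if b: "orthonormal_basis b" for b
  proof -
    have "(\<lambda>n. compressed_trace b n X - (\<Sum>k. cinner (h k) (f k))) \<longlonglongrightarrow> 0"
    proof (rule Lim_null_comparison[OF always_eventually nuclear_tail_tendsto_0[OF b f h]])
      show "\<forall>n. norm (compressed_trace b n X - (\<Sum>k. cinner (h k) (f k)))
          \<le> (\<Sum>k. norm (h k) * norm (f k - proj b n (f k)))"
        by (intro allI compressed_trace_nuclear orthonormal_seq_family orthonormal_basis_seq b f h X)
    qed
    then show ?thesis by (simp add: sums_def compressed_trace_def LIM_zero_iff)
  qed
  then show "\<forall>b. orthonormal_basis b \<longrightarrow>
      (\<lambda>k. cinner (X (b k)) (b k)) sums (\<Sum>k. cinner (h k) (f k))" by simp
  fix t assume "\<forall>b. orthonormal_basis b \<longrightarrow> (\<lambda>k. cinner (X (b k)) (b k)) sums t"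
  then have "(\<lambda>k. cinner (X (e k)) (e k)) sums t" using e by simp
  then show "t = (\<Sum>k. cinner (h k) (f k))" using sums[OF e] sums_unique2 by blast
qed

lemma cmod_cinner_swap: "cmod (cinner x y) = cmod (cinner y (x::'h::chilbert_space))"
  by (metis cinner_commute complex_mod_cnj)

text \<open>
  Both sides are the sum of \<open>\<bar>\<langle>D e\<^sub>j, b\<^sub>k\<rangle>\<bar>\<^sup>2\<close>, summed in different orders. Applying
  this twice shows that the Hilbert-Schmidt norm does not depend on the basis.
\<close>

lemma hilbert_schmidt_adj:
  fixes D :: "'h::chilbert_space \<Rightarrow>\<^sub>L 'h"
  assumes D: "D \<in> BH" and e: "orthonormal_basis e" and b: "orthonormal_basis b"
    and s: "summable (\<lambda>k. (norm (D (e k)))\<^sup>2)"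
  shows "summable (\<lambda>k. (norm (adj D (b k)))\<^sup>2)"
    and "(\<Sum>k. (norm (adj D (b k)))\<^sup>2) \<le> (\<Sum>k. (norm (D (e k)))\<^sup>2)"
proof -
  have 1: "(\<lambda>k. (cmod (cinner (D (e j)) (b k)))\<^sup>2) sums (norm (D (e j)))\<^sup>2" for j
    by (rule Parseval[OF b])
  have "(\<lambda>j. (cmod (cinner (adj D (b k)) (e j)))\<^sup>2) sums (norm (adj D (b k)))\<^sup>2" for k
    by (rule Parseval[OF e])
  then have 2: "(\<lambda>j. (cmod (cinner (D (e j)) (b k)))\<^sup>2) sums (norm (adj D (b k)))\<^sup>2" for k
    by (simp add: cinner_adj[OF D] cmod_cinner_swap[of "adj D _"])
  show "summable (\<lambda>k. (norm (adj D (b k)))\<^sup>2)"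
    "(\<Sum>k. (norm (adj D (b k)))\<^sup>2) \<le> (\<Sum>k. (norm (D (e k)))\<^sup>2)"
    using double_sums_swap[OF _ 1 2 s] by simp_all
qed

lemma hilbert_schmidt_norm:
  fixes D :: "'h::chilbert_space \<Rightarrow>\<^sub>L 'h"
  assumes D: "D \<in> BH" and e: "orthonormal_basis e" and s: "summable (\<lambda>k. (norm (D (e k)))\<^sup>2)"
  shows "hilbert_schmidt D" "(hs_norm D)\<^sup>2 = (\<Sum>k. (norm (D (e k)))\<^sup>2)"
proof -
  have basis: "summable (\<lambda>k. (norm (D (b k)))\<^sup>2)" "(\<Sum>k. (norm (D (b k)))\<^sup>2) \<le> (\<Sum>k. (norm (D (c k)))\<^sup>2)"
    if b: "orthonormal_basis b" and c: "orthonormal_basis c" "summable (\<lambda>k. (norm (D (c k)))\<^sup>2)" for b c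
    using hilbert_schmidt_adj[OF D c(1) c(1) c(2)] hilbert_schmidt_adj[of "adj D" c b] D b c
    by (auto intro: order_trans)
  then show "hilbert_schmidt D" using D e s by (auto simp: hilbert_schmidt_def)
  have "(THE s. \<forall>b. orthonormal_basis b \<longrightarrow> (\<lambda>k. (norm (D (b k)))\<^sup>2) sums s) = (\<Sum>k. (norm (D (e k)))\<^sup>2)"
  proof (rule the_equality)
    have "(\<lambda>k. (norm (D (b k)))\<^sup>2) sums (\<Sum>k. (norm (D (e k)))\<^sup>2)" if b: "orthonormal_basis b" for b
      using basis[OF b e s] basis(2)[OF e b basis(1)[OF b e s]] summable_sums[OF basis(1)[OF b e s]]
      by (metis order_antisym)
    then show "\<forall>b. orthonormal_basis b \<longrightarrow> (\<lambda>k. (norm (D (b k)))\<^sup>2) sums (\<Sum>k. (norm (D (e k)))\<^sup>2)"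
      by blast
    fix t assume "\<forall>b. orthonormal_basis b \<longrightarrow> (\<lambda>k. (norm (D (b k)))\<^sup>2) sums t"
    then show "t = (\<Sum>k. (norm (D (e k)))\<^sup>2)" using e sums_unique by blast
  qed
  then show "(hs_norm D)\<^sup>2 = (\<Sum>k. (norm (D (e k)))\<^sup>2)"
    by (simp add: hs_norm_def suminf_nonneg[OF s])
qed

text \<open>
  This writes the compressed trace of \<open>D\<^sup>* D\<close> through norms of projections onto the span of
  \<open>g\<close>, which are monotone in that span.
\<close>

lemma compressed_square_sums:
  fixes D :: "'h::chilbert_space \<Rightarrow>\<^sub>L 'h"
  assumes D: "D \<in> BH" and e: "orthonormal_basis e" and g: "orthonormal_family g m"
  shows "(\<lambda>i. (norm (proj g m (adj D (e i))))\<^sup>2) sums (\<Sum>j<m. (norm (D (g j)))\<^sup>2)"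
proof -
  have "(\<lambda>i. \<Sum>j<m. (cmod (cinner (D (g j)) (e i)))\<^sup>2) sums (\<Sum>j<m. (norm (D (g j)))\<^sup>2)"
    by (intro sums_sum Parseval e)
  then show ?thesis
    by (simp add: norm_proj_square[OF g] cinner_adj[OF D] cmod_cinner_swap[of "adj D _"])
qed

lemma compressed_square_bounds:
  fixes D :: "'h::chilbert_space \<Rightarrow>\<^sub>L 'h"
  assumes D: "D \<in> BH" and e: "orthonormal_basis e" and g: "orthonormal_family g m"
  shows "(\<And>k. k < n \<Longrightarrow> proj g m (e k) = e k) \<Longrightarrow>
      (\<Sum>k<n. (norm (D (e k)))\<^sup>2) \<le> (\<Sum>j<m. (norm (D (g j)))\<^sup>2)"
    and "summable (\<lambda>k. (norm (D (e k)))\<^sup>2) \<Longrightarrow>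
      (\<Sum>j<m. (norm (D (g j)))\<^sup>2) \<le> (\<Sum>k. (norm (D (e k)))\<^sup>2)"
proof -
  note ef = orthonormal_seq_family[OF orthonormal_basis_seq[OF e], of n]
  assume fixed: "\<And>k. k < n \<Longrightarrow> proj g m (e k) = e k"
  show "(\<Sum>k<n. (norm (D (e k)))\<^sup>2) \<le> (\<Sum>j<m. (norm (D (g j)))\<^sup>2)"
  proof (rule sums_le[OF _ compressed_square_sums[OF D e ef] compressed_square_sums[OF D e g]])
    fix i
    have "(norm (adj D (e i) - proj g m (adj D (e i))))\<^sup>2 \<le> (norm (adj D (e i) - proj e n (adj D (e i))))\<^sup>2"
      by (intro power_mono norm_diff_proj_mono[OF g fixed]) auto
    then show "(norm (proj e n (adj D (e i))))\<^sup>2 \<le> (norm (proj g m (adj D (e i))))\<^sup>2"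
      using norm_square_proj_split[OF ef, of "adj D (e i)"] norm_square_proj_split[OF g, of "adj D (e i)"]
      by linarith
  qed
next
  assume s: "summable (\<lambda>k. (norm (D (e k)))\<^sup>2)"
  note a = hilbert_schmidt_adj[OF D e e s]
  have "(\<Sum>j<m. (norm (D (g j)))\<^sup>2) \<le> (\<Sum>k. (norm (adj D (e k)))\<^sup>2)"
    by (rule sums_le[OF _ compressed_square_sums[OF D e g] summable_sums[OF a(1)]])
      (intro power_mono norm_proj_le[OF g] norm_ge_zero)
  then show "(\<Sum>j<m. (norm (D (g j)))\<^sup>2) \<le> (\<Sum>k. (norm (D (e k)))\<^sup>2)" using a(2) by linarith
qed

text \<open>
  As the subspace grows, the compressed traces of \<open>D\<^sup>* D\<close> increase to the sum of
  \<open>\<parallel>D (e k)\<parallel>\<^sup>2\<close>, finite or not, and those of \<open>X\<close> converge to its trace. If the limits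
  differ, so do the compressed traces, by a fixed amount on every subspace that contains sufficiently
  many of the vectors \<open>e k\<close>.
\<close>

lemma compressed_trace_gap:
  fixes D X :: "'h::chilbert_space \<Rightarrow>\<^sub>L 'h"
  assumes D: "D \<in> BH" and e: "orthonormal_basis e"
    and f: "orthonormal_seq f" and h: "summable (\<lambda>k. norm (h k))"
    and X: "\<And>x. (\<lambda>k. cinner x (f k) *\<^sub>C h k) sums X x"
    and neq: "\<not> (summable (\<lambda>k. (norm (D (e k)))\<^sup>2) \<and>
       complex_of_real (\<Sum>k. (norm (D (e k)))\<^sup>2) = (\<Sum>k. cinner (h k) (f k)))"
  obtains c N where "c > 0" "\<forall>n g m. n \<ge> N \<longrightarrow> orthonormal_family g m \<longrightarrow>
    (\<forall>k<n. proj g m (e k) = e k) \<longrightarrow>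
    c \<le> cmod (complex_of_real (\<Sum>j<m. (norm (D (g j)))\<^sup>2) - compressed_trace g m X)"
proof -
  define t where "t = (\<Sum>k. cinner (h k) (f k))"
  define a where "a n = (\<Sum>k. norm (h k) * norm (f k - proj e n (f k)))" for n
  have a: "a \<longlonglongrightarrow> 0" unfolding a_def by (rule nuclear_tail_tendsto_0[OF e f h])
  have tr: "cmod (compressed_trace g m X - t) \<le> a n"
    if g: "orthonormal_family g m" and fixed: "\<And>k. k < n \<Longrightarrow> proj g m (e k) = e k" for g m n
  proof -
    have bound: "summable (\<lambda>k. norm (h k) * norm (f k - proj g m (f k)))"
      if g: "orthonormal_family g m" for g m
    proof (rule summable_comparison_test[OF _ h], intro exI allI impI)
      show "norm (norm (h k) * norm (f k - proj g m (f k))) \<le> norm (h k)" for k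
        using norm_diff_proj_le[OF g, of "f k"] orthonormal_seq_norm[OF f, of k]
        by (simp add: mult_left_le)
    qed
    have "cmod (compressed_trace g m X - t) \<le> (\<Sum>k. norm (h k) * norm (f k - proj g m (f k)))"
      unfolding t_def by (rule compressed_trace_nuclear[OF g f h X])
    also have "\<dots> \<le> a n"
      unfolding a_def
      by (intro suminf_le mult_left_mono norm_diff_proj_mono[OF g fixed] bound g
          orthonormal_seq_family[OF orthonormal_basis_seq[OF e]]) auto
    finally show ?thesis .
  qed
  define p where "p n = (\<Sum>k<n. (norm (D (e k)))\<^sup>2)" for n
  show ?thesis
  proof (cases "summable (\<lambda>k. (norm (D (e k)))\<^sup>2)")
    case True
    define s where "s = (\<Sum>k. (norm (D (e k)))\<^sup>2)"
    define c where "c = cmod (complex_of_real s - t) / 3"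
    have c: "c > 0" using neq True by (simp add: c_def s_def t_def)
    have c3: "3 * c = cmod (complex_of_real s - t)" by (simp add: c_def)
    have p: "p \<longlonglongrightarrow> s" unfolding p_def s_def by (rule summable_LIMSEQ[OF True])
    obtain N where N: "\<And>n. n \<ge> N \<Longrightarrow> a n < c" "\<And>n. n \<ge> N \<Longrightarrow> s - c < p n"
      using eventually_conj[OF order_tendstoD(2)[OF a c] order_tendstoD(1)[OF p, of "s - c"]] c
      by (auto simp: eventually_sequentially)
    show ?thesis
    proof (rule that[OF c], intro allI impI)
      fix n g m assume n: "n \<ge> N" and g: "orthonormal_family g m" and fixed: "\<forall>k<n. proj g m (e k) = e k"
      define q where "q = (\<Sum>j<m. (norm (D (g j)))\<^sup>2)"
      have "p n \<le> q" "q \<le> s"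
        using compressed_square_bounds[OF D e g] fixed True by (auto simp: p_def q_def s_def)
      then have "\<bar>s - q\<bar> \<le> c" using N(2)[OF n] by linarith
      then have "cmod (complex_of_real s - complex_of_real q) \<le> c" by (simp flip: of_real_diff)
      moreover have "cmod (compressed_trace g m X - t) \<le> c"
        using tr[OF g, of n] fixed N(1)[OF n] by fastforce
      moreover have "complex_of_real s - t = (complex_of_real s - complex_of_real q) +
          (complex_of_real q - compressed_trace g m X) + (compressed_trace g m X - t)" by simp
      then have "3 * c \<le> cmod (complex_of_real s - complex_of_real q) +
          cmod (complex_of_real q - compressed_trace g m X) + cmod (compressed_trace g m X - t)"
        by (simp only: c3) (intro norm_triangle_le add_right_mono norm_triangle_ineq)
      ultimately show "c \<le> cmod (complex_of_real (\<Sum>j<m. (norm (D (g j)))\<^sup>2) - compressed_trace g m X)"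
        unfolding q_def by linarith
    qed
  next
    case False
    have "\<exists>n. cmod t + 2 < p n"
    proof (rule ccontr)
      assume "\<nexists>n. cmod t + 2 < p n"
      then have "(\<Sum>k<n. (norm (D (e k)))\<^sup>2) \<le> cmod t + 2" for n by (auto simp: p_def not_less)
      then have "summable (\<lambda>k. (norm (D (e k)))\<^sup>2)" by (intro summableI_nonneg_bounded) auto
      then show False using False by simp
    qed
    then obtain N0 where N0: "cmod t + 2 < p N0" by blast
    obtain N1 where N1: "\<And>n. n \<ge> N1 \<Longrightarrow> a n < 1"
      using order_tendstoD(2)[OF a, of 1] by (auto simp: eventually_sequentially)
    show ?thesis
    proof (rule that[of 1 "max N0 N1"], simp, intro allI impI)
      fix n g m assume n: "n \<ge> max N0 N1" and g: "orthonormal_family g m"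
        and fixed: "\<forall>k<n. proj g m (e k) = e k"
      define q where "q = (\<Sum>j<m. (norm (D (g j)))\<^sup>2)"
      have "p N0 \<le> p n" unfolding p_def using n by (intro sum_mono2) auto
      moreover have "p n \<le> q"
        using compressed_square_bounds(1)[OF D e g] fixed by (auto simp: p_def q_def)
      ultimately have q: "cmod t + 2 \<le> q" using N0 by linarith
      have "cmod (compressed_trace g m X - t) \<le> 1"
        using tr[OF g, of n] fixed N1[of n] n by fastforce
      then have "cmod (compressed_trace g m X) \<le> cmod t + 1"
        using norm_triangle_ineq2[of "compressed_trace g m X" t] by linarith
      moreover have "q \<le> cmod (complex_of_real q)" by simp
      then have "q - cmod (compressed_trace g m X) \<le> cmod (complex_of_real q - compressed_trace g m X)"
        using norm_triangle_ineq2[of "complex_of_real q" "compressed_trace g m X"] by linarith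
      ultimately show "1 \<le> cmod (complex_of_real (\<Sum>j<m. (norm (D (g j)))\<^sup>2) - compressed_trace g m X)"
        using q unfolding q_def by linarith
    qed
  qed
qed

section \<open>The trace identity\<close>

text \<open>
  For each \<open>n\<close> take a subspace of dimension at most \<open>K n\<close> that contains the first \<open>n\<close> basis
  vectors and off which every \<open>Z i\<close> and its adjoint are bounded by \<open>2 d n\<close>. The gap \<open>c\<close> is then
  at most a constant times \<open>n * d n\<close>.
\<close>

lemma omega_in_ideal_if_trace_gap:
  fixes X Y :: "'h::separable_infinite_dim_chilbert_space \<Rightarrow>\<^sub>L 'h"
  assumes e: "orthonormal_basis e" and S: "two_sided_ideal S"
    and I: "finite I" and Z: "\<And>i. i \<in> I \<Longrightarrow> Z i \<in> S" and B: "\<And>i. i \<in> I \<Longrightarrow> B i \<in> BH"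
    and Y: "Y = (\<Sum>i\<in>I. B i o\<^sub>L Z i)" and X: "X = (\<Sum>i\<in>I. Z i o\<^sub>L B i)"
    and c: "c > 0"
    and gap: "\<And>n g m. n \<ge> N \<Longrightarrow> orthonormal_family g m \<Longrightarrow> (\<And>k. k < n \<Longrightarrow> proj g m (e k) = e k) \<Longrightarrow>
      c \<le> cmod (compressed_trace g m Y - compressed_trace g m X)"
  shows "diag_op e omega \<in> S"
proof -
  obtain D d V where D: "D \<in> S" "\<forall>n. D (e n) = complex_of_real (d n) *\<^sub>C e n"
    and V: "sparse_constraints (4 * card I) d V"
    and dom: "\<forall>i\<in>I. dominated_off V d (Z i) \<and> dominated_off V d (adj (Z i))"
    using ideal_common_diagonal[of e S I Z] e S I Z by blast
  have d: "0 \<le> d n" "n \<le> m \<Longrightarrow> d m \<le> 2 * d n" "finite (V n)" "card (V n) \<le> 4 * card I * n" for m n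
    using V by (auto simp: sparse_constraints_def)
  define K where "K = 4 * card I + 1"
  define b where "b = (\<Sum>i\<in>I. norm (B i))"
  define C where "C = 4 * real K * b"
  have b0: "0 \<le> b" by (simp add: b_def sum_nonneg)
  have main: "c \<le> C * (real n * d n)" if n: "n \<ge> N" for n
  proof -
    have "finite (V n \<union> e ` {..<n})" using d(3) by simp
    then obtain g m where g: "orthonormal_family g m" and m: "m \<le> card (V n \<union> e ` {..<n})"
      and fixed: "\<And>v. v \<in> V n \<union> e ` {..<n} \<Longrightarrow> proj g m v = v"
      using Gram_Schmidt by metis
    have "card (V n \<union> e ` {..<n}) \<le> card (V n) + card (e ` {..<n})" by (rule card_Un_le)
    also have "\<dots> \<le> 4 * card I * n + n" using d(4)[of n] card_image_le[of "{..<n}" e] by simp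
    finally have m: "m \<le> K * n" using m by (simp add: K_def)
    have orth: "cinner y v = 0" if "\<And>j. j < m \<Longrightarrow> cinner y (g j) = 0" "v \<in> V n" for y v
    proof -
      have "cinner y v = cinner y (proj g m v)" using fixed that(2) by simp
      also have "\<dots> = 0" using that(1) by (simp add: cinner_proj_right)
      finally show ?thesis .
    qed
    have small: "norm (Z i y) \<le> 2 * d n * norm y \<and> norm (adj (Z i) y) \<le> 2 * d n * norm y"
      if "i \<in> I" "\<And>j. j < m \<Longrightarrow> cinner y (g j) = 0" for i y
      using dom that orth unfolding dominated_off_def by blast
    have ct_sum: "compressed_trace g m (\<Sum>i\<in>I. F i) = (\<Sum>i\<in>I. compressed_trace g m (F i))" for F
      unfolding compressed_trace_def blinfun.sum_left cinner_sum_left by (rule sum.swap)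
    have "c \<le> cmod (compressed_trace g m X - compressed_trace g m Y)"
      using gap[OF n g] fixed by (simp add: norm_minus_commute)
    also have "\<dots> = cmod (\<Sum>i\<in>I. compressed_trace g m (Z i o\<^sub>L B i) - compressed_trace g m (B i o\<^sub>L Z i))"
      by (simp add: X Y ct_sum sum_subtractf)
    also have "\<dots> \<le> (\<Sum>i\<in>I. cmod (compressed_trace g m (Z i o\<^sub>L B i) - compressed_trace g m (B i o\<^sub>L Z i)))"
      by (rule norm_sum)
    also have "\<dots> \<le> (\<Sum>i\<in>I. 2 * real m * (2 * d n) * norm (B i))"
      using ideal_BH[OF S Z] B small d(1)
      by (intro sum_mono compressed_trace_commutator[OF g]) auto
    also have "\<dots> = real m * (4 * d n * b)" by (simp add: b_def sum_distrib_left mult_ac)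
    also have "\<dots> \<le> real (K * n) * (4 * d n * b)"
      using m d(1)[of n] b0 by (intro mult_right_mono) (auto simp del: of_nat_mult)
    also have "\<dots> = C * (real n * d n)" by (simp add: C_def)
    finally show ?thesis .
  qed
  have "0 < C"
  proof (rule ccontr)
    assume "\<not> 0 < C"
    then have "C * (real N * d N) \<le> 0" using d(1)[of N] by (intro mult_nonpos_nonneg) auto
    then show False using main[of N] c by simp
  qed
  show ?thesis
  proof (rule omega_in_ideal[OF e S D(1), of d "c / C" N])
    show "c / C \<le> real n * d n" if "n \<ge> N" for n
      using main[OF that] \<open>0 < C\<close> by (simp add: field_simps)
  qed (use D(2) d(2) c \<open>0 < C\<close> in auto)
qed

text \<open>
  The last two conclusions give the Hilbert-Schmidt norm in the basis \<open>e\<close>, so that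
  \<open>\<Delta>(T) = 0\<close> can be read off when the trace is 0.
\<close>

lemma trace_identity:
  fixes A B :: "nat \<Rightarrow> ('h::separable_infinite_dim_chilbert_space \<Rightarrow>\<^sub>L 'h)"
  assumes coeff: "\<forall>i\<in>{1..n}. A i \<in> BH" "\<forall>i\<in>{1..n}. B i \<in> BH" and T: "T \<in> BH"
    and e: "orthonormal_basis e" and omega: "diag_op e omega \<notin> S_ideal n A B T"
    and tc: "trace_class (elem_op_star n A B (elem_op n A B T))"
  shows "hilbert_schmidt (elem_op n A B T)"
    "complex_of_real ((hs_norm (elem_op n A B T))\<^sup>2) =
       op_trace (adj T o\<^sub>L elem_op_star n A B (elem_op n A B T))"
    "(hs_norm (elem_op n A B T))\<^sup>2 = (\<Sum>k. (norm (elem_op n A B T (e k)))\<^sup>2)"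
    "summable (\<lambda>k. (norm (elem_op n A B T (e k)))\<^sup>2)"
proof -
  have A: "A i \<in> BH" and B: "B i \<in> BH" if "i \<in> {1..n}" for i using coeff that by auto
  define S where "S = S_ideal n A B T"
  define D where "D = elem_op n A B T"
  define L where "L = elem_op_star n A B D"
  have S: "two_sided_ideal S" unfolding S_def by (rule two_sided_ideal_S_ideal[OF A B T])
  have DS: "D \<in> S" unfolding S_def D_def by (rule elem_op_in_S_ideal[OF A B T])
  have DB: "D \<in> BH" by (rule ideal_BH[OF S DS])
  have LS: "L \<in> S"
    unfolding L_def elem_op_star_def elem_op_def
    by (intro ideal_sum_mem[OF S] ideal_right[OF S] ideal_left[OF S] DS adj_BH A B)
  have "compact_op L"
    using compact_if_omega_notin[OF e S LS] omega by (simp add: S_def)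
  then obtain f where f: "orthonormal_seq f" and Lf: "summable (\<lambda>k. norm (L (f k)))"
    and Lx: "\<forall>x. (\<lambda>k. cinner x (f k) *\<^sub>C L (f k)) sums L x"
    using trace_class_expansion[of L] tc by (auto simp: L_def D_def)
  define h where "h k = adj T (L (f k))" for k
  define X where "X = adj T o\<^sub>L L"
  have h: "summable (\<lambda>k. norm (h k))"
  proof (rule summable_comparison_test[OF _ summable_mult[OF Lf, of "norm (adj T)"]], intro exI allI impI)
    show "norm (norm (h k)) \<le> norm (adj T) * norm (L (f k))" for k
      using norm_blinfun[of "adj T" "L (f k)"] by (simp add: h_def)
  qed
  have X: "(\<lambda>k. cinner x (f k) *\<^sub>C h k) sums X x" for x
    using bounded_linear.sums[OF blinfun.bounded_linear_right, of _ _ "adj T"] Lx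
    by (simp add: X_def h_def BH_scaleC[OF adj_BH[OF T], symmetric])
  define Z where "Z i = (adj T o\<^sub>L adj (A i)) o\<^sub>L D" for i
  have Z: "Z i \<in> S" if "i \<in> {1..n}" for i
    unfolding Z_def by (rule ideal_left[OF S DS]) (simp add: T A[OF that])
  have XZ: "X = (\<Sum>i\<in>{1..n}. Z i o\<^sub>L adj (B i))"
    unfolding X_def L_def elem_op_star_def elem_op_def Z_def compose_sum_right
    by (intro sum.cong refl blinfun_eqI) simp
  have "adj D = (\<Sum>i\<in>{1..n}. adj (B i) o\<^sub>L (adj T o\<^sub>L adj (A i)))"
    unfolding D_def elem_op_def using A B T
    by (subst adj_sum) (auto simp: adj_compose intro!: sum.cong)
  then have DZ: "adj D o\<^sub>L D = (\<Sum>i\<in>{1..n}. adj (B i) o\<^sub>L Z i)"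
    unfolding Z_def by (simp add: compose_sum_left) (intro sum.cong refl blinfun_eqI, simp)
  have ct: "compressed_trace g m (adj D o\<^sub>L D) = complex_of_real (\<Sum>j<m. (norm (D (g j)))\<^sup>2)" for g m
    by (simp add: compressed_trace_def cinner_adj_left[OF DB] cinner_self)
  have good: "summable (\<lambda>k. (norm (D (e k)))\<^sup>2) \<and>
     complex_of_real (\<Sum>k. (norm (D (e k)))\<^sup>2) = (\<Sum>k. cinner (h k) (f k))"
  proof (rule ccontr)
    assume neq: "\<not> ?thesis"
    obtain c N where c: "c > 0" and gap: "\<forall>n g m. n \<ge> N \<longrightarrow> orthonormal_family g m \<longrightarrow>
        (\<forall>k<n. proj g m (e k) = e k) \<longrightarrow>
        c \<le> cmod (complex_of_real (\<Sum>j<m. (norm (D (g j)))\<^sup>2) - compressed_trace g m X)"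
      using compressed_trace_gap[OF DB e f h X neq] by blast
    have "diag_op e omega \<in> S"
      by (rule omega_in_ideal_if_trace_gap[OF e S _ Z _ DZ XZ c])
        (use gap B in \<open>auto simp: ct\<close>)
    then show False using omega by (simp add: S_def)
  qed
  show "hilbert_schmidt (elem_op n A B T)"
    "(hs_norm (elem_op n A B T))\<^sup>2 = (\<Sum>k. (norm (elem_op n A B T (e k)))\<^sup>2)"
    "summable (\<lambda>k. (norm (elem_op n A B T (e k)))\<^sup>2)"
    using hilbert_schmidt_norm[OF DB e] good by (auto simp: D_def)
  then show "complex_of_real ((hs_norm (elem_op n A B T))\<^sup>2) =
       op_trace (adj T o\<^sub>L elem_op_star n A B (elem_op n A B T))"
    using good op_trace_nuclear[OF e f h X] by (simp add: X_def D_def L_def)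
qed

theorem proposition5p8:
  fixes n :: nat
    and A B :: "nat \<Rightarrow> ('h::separable_infinite_dim_chilbert_space \<Rightarrow>\<^sub>L 'h)"
    and T :: "'h \<Rightarrow>\<^sub>L 'h"
    and e :: "nat \<Rightarrow> 'h"
  assumes "n \<ge> 1"
    and "\<And>i. i \<in> {1..n} \<Longrightarrow> A i \<in> BH"
    and "\<And>i. i \<in> {1..n} \<Longrightarrow> B i \<in> BH"
    and "T \<in> BH"
    and "orthonormal_basis e"
    and "diag_op e omega \<notin> S_ideal n A B T"
  shows "(trace_class (elem_op_star n A B (elem_op n A B T)) \<longrightarrow>
            hilbert_schmidt (elem_op n A B T) \<and>
            complex_of_real ((hs_norm (elem_op n A B T))\<^sup>2) =
              op_trace (adj T o\<^sub>L elem_op_star n A B (elem_op n A B T))) \<and>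
         (elem_op_star n A B (elem_op n A B T) = 0 \<longrightarrow> elem_op n A B T = 0)"
proof -
  have coeff: "\<forall>i\<in>{1..n}. A i \<in> BH" "\<forall>i\<in>{1..n}. B i \<in> BH" using assms(2,3) by auto
  show ?thesis
proof (intro conjI impI)
  assume "trace_class (elem_op_star n A B (elem_op n A B T))"
  from trace_identity(1,2)[OF coeff assms(4-6) this]
  show "hilbert_schmidt (elem_op n A B T)"
    "complex_of_real ((hs_norm (elem_op n A B T))\<^sup>2) =
      op_trace (adj T o\<^sub>L elem_op_star n A B (elem_op n A B T))" .
next
  define D where "D = elem_op n A B T"
  assume zero: "elem_op_star n A B (elem_op n A B T) = 0"
  then have "trace_class (elem_op_star n A B (elem_op n A B T))"
    using trace_class_zero[OF assms(5)] by simp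
  note tr = trace_identity[OF coeff assms(4-6) this, folded D_def]
  have "op_trace (adj T o\<^sub>L elem_op_star n A B D) = 0"
    using op_trace_nuclear[OF assms(5) orthonormal_basis_seq[OF assms(5)], of "\<lambda>_. 0" 0] zero
    by (simp add: D_def)
  then have "(\<Sum>k. (norm (D (e k)))\<^sup>2) = 0" using tr(2,3) by simp
  then have "D (e k) = 0" for k
    using suminf_eq_zero_iff[OF tr(4)] by simp
  moreover have "D \<in> BH"
    unfolding D_def using ideal_BH[OF two_sided_ideal_S_ideal elem_op_in_S_ideal] assms(2-4) by blast
  ultimately have "D = 0" by (intro BH_eqI_basis[OF assms(5)]) auto
  then show "elem_op n A B T = 0" by (simp add: D_def)
qed
qed

end
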